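(* Let $\mathcal{A}$ be a unital $C^*$-algebra and let $F \in B^{a}(H_{\mathcal{A}})$. Then $$\sigma_{eW}^{\mathcal{A}}(F)=\bigcap \{\, \sigma^{\mathcal{A}}(PF_{|R(P)}) \mid P\in \mathrm{P}(H_{\mathcal{A}}) \,\},$$ where $\sigma_{eW}^{\mathcal{A}}(F)=\{\alpha\in Z(\mathcal{A}) \mid F-\alpha I\notin \tilde{\mathcal{M}\Phi}_{0}(H_{\mathcal{A}})\}$ and, for $P\in \mathrm{P}(H_{\mathcal{A}})$, $$\sigma^{\mathcal{A}}(PF_{|R(P)})=\{\alpha\in Z(\mathcal{A}) \mid (PF-\alpha I)_{|R(P)} \text{ is not invertible in } B(R(P))\}.$$
   Context: $\mathcal{A}$ is a unital $C^*$-algebra with center $Z(\mathcal{A})$; $H_{\mathcal{A}}$ is the standard countably generated (right) Hilbert $\mathcal{A}$-module. $B(M)$ is the set of bounded $\mathcal{A}$-linear operators on $M$, and $B^a(H_{\mathcal{A}})$ the set of bounded adjointable operators on $H_{\mathcal{A}}$. For $\alpha\in Z(\mathcal{A})$, $\alpha I$ is the operator $x\mapsto x\alpha$ (it maps $R(P)$ into $R(P)$ for every $\mathcal{A}$-linear idempotent $P$). $R(T)$ and $N(T)$ denote image and kernel of $T$. $\tilde\oplus$ denotes the internal direct sum of closed submodules, not necessarily orthogonal. A Hilbert module is finitely generated if it equals the $\mathcal{A}$-linear span of a finite subset. "Isomorphism" between closed submodules means a bounded bijective $\mathcal{A}$-linear map (with bounded inverse). "Projection" means a not necessarily orthogonal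 (skew) projection, i.e. an idempotent. $\mathrm{P}(H_{\mathcal{A}})=\{P\in B(H_{\mathcal{A}}) \mid P \text{ is a projection and } N(P) \text{ is finitely generated}\}$. "$F$ has matrix $\begin{bmatrix}F_1&0\\0&F_4\end{bmatrix}$ with respect to the decomposition $H_{\mathcal{A}}=M_1\tilde\oplus N_1\stackrel{F}{\longrightarrow}M_2\tilde\oplus N_2=H_{\mathcal{A}}$" means that $F(M_1)\subseteq M_2$, $F(N_1)\subseteq N_2$, $F_1=F_{|M_1}:M_1\to M_2$ and $F_4=F_{|N_1}:N_1\to N_2$; here all four submodules are closed. $\tilde{\mathcal{M}\Phi}_{0}(H_{\mathcal{A}})$ is the set of all $F\in B^a(H_{\mathcal{A}})$ for which there is a decomposition $H_{\mathcal{A}}=M_1\tilde\oplus N_1\stackrel{F}{\longrightarrow}M_2\tilde\oplus N_2=H_{\mathcal{A}}$ with respect to which $F$ has matrix $\begin{bmatrix}F_1&0\\0&F_4\end{bmatrix}$, where $F_1$ is an isomorphism, $N_1,N_2$ are finitely generated, and $N\tilde\oplus N_1=N\tilde\oplus N_2=H_{\mathcal{A}}$ for some closed submodule $N\subseteq H_{\mathcal{A}}$. *)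

theory Defs
  imports Complex_Main "HOL-Library.Function_Algebras"
begin

text \<open>
  Unital \<open>C\<close>*-algebras. The unit comes from \<^class>\<open>monoid_mult\<close> rather than from
  \<^class>\<open>real_normed_algebra_1\<close>, so that the zero algebra is not excluded; in the other
  cases \<open>norm 1 = 1\<close> is a consequence of the axioms.
\<close>

class unital_cstar_algebra = real_normed_algebra + monoid_mult + banach +
  fixes scaleC :: "complex \<Rightarrow> 'a \<Rightarrow> 'a"
    and star :: "'a \<Rightarrow> 'a"
  assumes scaleC_add_right: "scaleC c (x + y) = scaleC c x + scaleC c y"
    and scaleC_add_left: "scaleC (c + d) x = scaleC c x + scaleC d x"
    and scaleC_scaleC: "scaleC c (scaleC d x) = scaleC (c * d) x"
    and scaleC_of_real: "scaleC (complex_of_real r) x = r *\<^sub>R x"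
    and scaleC_mult_left: "scaleC c x * y = scaleC c (x * y)"
    and scaleC_mult_right: "x * scaleC c y = scaleC c (x * y)"
    and norm_scaleC: "norm (scaleC c x) = cmod c * norm x"
    and star_add: "star (x + y) = star x + star y"
    and star_scaleC: "star (scaleC c x) = scaleC (cnj c) (star x)"
    and star_mult: "star (x * y) = star y * star x"
    and star_star: "star (star x) = x"
    and norm_star_mult_self: "norm (star x * x) = (norm x)\<^sup>2"

definition alg_center :: "'a::unital_cstar_algebra set" where
  "alg_center = {a. \<forall>b. a * b = b * a}"

text \<open>
  The standard module \<open>H\<^sub>A\<close> consists of the sequences \<open>x\<close> in the algebra for which
  \<open>\<Sum>n. x\<^sub>n* x\<^sub>n\<close> converges in norm. It is a set of functions and not a type, so operators
  on it are total functions on sequences of which only the values on the relevant submodule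
  matter. Addition of sequences is pointwise. The predefined topology on functions is the
  product topology, hence norm, boundedness and closedness are spelled out for \<open>HA_norm\<close>.
\<close>

definition HA :: "(nat \<Rightarrow> 'a::unital_cstar_algebra) set" where
  "HA = {x. summable (\<lambda>n. star (x n) * x n)}"

definition HA_inner :: "(nat \<Rightarrow> 'a) \<Rightarrow> (nat \<Rightarrow> 'a) \<Rightarrow> 'a::unital_cstar_algebra" where
  "HA_inner x y = (\<Sum>n. star (x n) * y n)"

definition HA_norm :: "(nat \<Rightarrow> 'a::unital_cstar_algebra) \<Rightarrow> real" where
  "HA_norm x = sqrt (norm (HA_inner x x))"

definition right_act :: "(nat \<Rightarrow> 'a) \<Rightarrow> 'a::unital_cstar_algebra \<Rightarrow> (nat \<Rightarrow> 'a)" where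
  "right_act x a = (\<lambda>n. x n * a)"

text \<open>Complex scalars act through the unit, so submodules and module maps are complex linear.\<close>

definition submodule :: "(nat \<Rightarrow> 'a::unital_cstar_algebra) set \<Rightarrow> bool" where
  "submodule M \<longleftrightarrow> M \<subseteq> HA \<and> 0 \<in> M \<and> (\<forall>x\<in>M. \<forall>y\<in>M. x + y \<in> M) \<and>
     (\<forall>x\<in>M. \<forall>a. right_act x a \<in> M)"

definition closed_submodule :: "(nat \<Rightarrow> 'a::unital_cstar_algebra) set \<Rightarrow> bool" where
  "closed_submodule M \<longleftrightarrow> submodule M \<and>
     (\<forall>X. \<forall>l\<in>HA. (\<forall>k. X k \<in> M) \<and> (\<lambda>k. HA_norm (X k - l)) \<longlonglongrightarrow> 0 \<longrightarrow> l \<in> M)"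

definition finitely_generated :: "(nat \<Rightarrow> 'a::unital_cstar_algebra) set \<Rightarrow> bool" where
  "finitely_generated M \<longleftrightarrow>
     (\<exists>S\<subseteq>HA. finite S \<and> M = range (\<lambda>c. \<Sum>s\<in>S. right_act s (c s)))"

definition direct_sum ::
    "(nat \<Rightarrow> 'a::unital_cstar_algebra) set \<Rightarrow> (nat \<Rightarrow> 'a) set \<Rightarrow> bool" where
  "direct_sum M N \<longleftrightarrow> closed_submodule M \<and> closed_submodule N \<and> M \<inter> N = {0} \<and>
     {x + y | x y. x \<in> M \<and> y \<in> N} = HA"

definition bounded_maps :: "(nat \<Rightarrow> 'a::unital_cstar_algebra) set \<Rightarrow> (nat \<Rightarrow> 'a) set \<Rightarrow>
    ((nat \<Rightarrow> 'a) \<Rightarrow> (nat \<Rightarrow> 'a)) set" where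
  "bounded_maps M N = {T. T ` M \<subseteq> N \<and> (\<forall>x\<in>M. \<forall>y\<in>M. T (x + y) = T x + T y) \<and>
     (\<forall>x\<in>M. \<forall>a. T (right_act x a) = right_act (T x) a) \<and>
     (\<exists>C. \<forall>x\<in>M. HA_norm (T x) \<le> C * HA_norm x)}"

abbreviation bounded_ops :: "(nat \<Rightarrow> 'a::unital_cstar_algebra) set \<Rightarrow>
    ((nat \<Rightarrow> 'a) \<Rightarrow> (nat \<Rightarrow> 'a)) set" where
  "bounded_ops M \<equiv> bounded_maps M M"

definition adjointable_ops ::
    "((nat \<Rightarrow> 'a::unital_cstar_algebra) \<Rightarrow> (nat \<Rightarrow> 'a)) set" where
  "adjointable_ops = {F \<in> bounded_ops HA.
     \<exists>G\<in>bounded_ops HA. \<forall>x\<in>HA. \<forall>y\<in>HA. HA_inner (F x) y = HA_inner x (G y)}"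

definition isomorphism :: "(nat \<Rightarrow> 'a::unital_cstar_algebra) set \<Rightarrow> (nat \<Rightarrow> 'a) set \<Rightarrow>
    ((nat \<Rightarrow> 'a) \<Rightarrow> (nat \<Rightarrow> 'a)) \<Rightarrow> bool" where
  "isomorphism M N T \<longleftrightarrow> T \<in> bounded_maps M N \<and> bij_betw T M N \<and>
     inv_into M T \<in> bounded_maps N M"

definition invertible_op :: "(nat \<Rightarrow> 'a::unital_cstar_algebra) set \<Rightarrow>
    ((nat \<Rightarrow> 'a) \<Rightarrow> (nat \<Rightarrow> 'a)) \<Rightarrow> bool" where
  "invertible_op M T \<longleftrightarrow> T \<in> bounded_ops M \<and>
     (\<exists>S\<in>bounded_ops M. \<forall>x\<in>M. S (T x) = x \<and> T (S x) = x)"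

definition op_range :: "((nat \<Rightarrow> 'a::unital_cstar_algebra) \<Rightarrow> (nat \<Rightarrow> 'a)) \<Rightarrow>
    (nat \<Rightarrow> 'a) set" where
  "op_range T = T ` HA"

definition op_kernel :: "((nat \<Rightarrow> 'a::unital_cstar_algebra) \<Rightarrow> (nat \<Rightarrow> 'a)) \<Rightarrow>
    (nat \<Rightarrow> 'a) set" where
  "op_kernel T = {x \<in> HA. T x = 0}"

definition fg_kernel_projections ::
    "((nat \<Rightarrow> 'a::unital_cstar_algebra) \<Rightarrow> (nat \<Rightarrow> 'a)) set" where
  "fg_kernel_projections = {P \<in> bounded_ops HA.
     (\<forall>x\<in>HA. P (P x) = P x) \<and> finitely_generated (op_kernel P)}"

definition MPhi0 :: "((nat \<Rightarrow> 'a::unital_cstar_algebra) \<Rightarrow> (nat \<Rightarrow> 'a)) set" where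
  "MPhi0 = {F \<in> adjointable_ops. \<exists>M1 N1 M2 N2.
     direct_sum M1 N1 \<and> direct_sum M2 N2 \<and> F ` M1 \<subseteq> M2 \<and> F ` N1 \<subseteq> N2 \<and>
     isomorphism M1 M2 F \<and> finitely_generated N1 \<and> finitely_generated N2 \<and>
     (\<exists>N. direct_sum N N1 \<and> direct_sum N N2)}"

definition essential_weyl_spectrum ::
    "((nat \<Rightarrow> 'a::unital_cstar_algebra) \<Rightarrow> (nat \<Rightarrow> 'a)) \<Rightarrow> 'a set" where
  "essential_weyl_spectrum F =
     {\<alpha> \<in> alg_center. (\<lambda>x. F x - right_act x \<alpha>) \<notin> MPhi0}"

definition compression_spectrum ::
    "((nat \<Rightarrow> 'a::unital_cstar_algebra) \<Rightarrow> (nat \<Rightarrow> 'a)) \<Rightarrow>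
     ((nat \<Rightarrow> 'a) \<Rightarrow> (nat \<Rightarrow> 'a)) \<Rightarrow> 'a set" where
  "compression_spectrum P F =
     {\<alpha> \<in> alg_center. \<not> invertible_op (op_range P) (\<lambda>x. P (F x) - right_act x \<alpha>)}"

end

theory Submission
  imports Defs "HOL-Analysis.Urysohn"
begin

text \<open>
  Put \<open>G = F - \<alpha>I\<close>. As \<open>P\<close> is linear over the algebra and fixes \<open>R(P)\<close>, the operator
  \<open>PF - \<alpha>I\<close> agrees with \<open>PG\<close> on \<open>R(P)\<close>. So the claim is that an adjointable \<open>G\<close> is a Weyl
  operator if and only if, for some idempotent \<open>P\<close> with finitely generated kernel, its compression
  \<open>PG\<close> to \<open>R(P)\<close> is invertible.

  Suppose that \<open>S\<close> inverts the compression (\<open>MPhi0_if_compression_invertible\<close>). Block elimination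
  with the invertible corner \<open>PG\<close> diagonalises \<open>G\<close> with respect to
  \<open>R(P) \<oplus> N(PG) \<rightarrow> G(R(P)) \<oplus> N(P)\<close>. The projections of these two decompositions are \<open>SPG\<close> and
  \<open>GSP\<close>, and \<open>R(P)\<close> is a common complement of \<open>N(PG)\<close> and \<open>N(P)\<close>.

  Conversely let \<open>G\<close> be diagonal with respect to \<open>M\<^sub>1 \<oplus> N\<^sub>1 \<rightarrow> M\<^sub>2 \<oplus> N\<^sub>2\<close> and let \<open>N\<close> be a common
  complement of \<open>N\<^sub>1\<close> and \<open>N\<^sub>2\<close> (\<open>compression_invertible_if_MPhi0\<close>). The projection \<open>P\<close> onto \<open>N\<close>
  along \<open>N\<^sub>2\<close> has the required compression, because any two complements of \<open>N\<^sub>i\<close> are isomorphic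
  along \<open>N\<^sub>i\<close>: \<open>PG\<close> is the composite of isomorphisms \<open>N \<rightarrow> M\<^sub>1 \<rightarrow> M\<^sub>2 \<rightarrow> N\<close>.

  This second half uses that the projection belonging to a direct sum of closed submodules is
  bounded (\<open>projection_along_bounded\<close>). That is the open mapping theorem for the addition map, hence
  a consequence of the Baire category theorem and of the completeness of the standard module.
  That the standard module is a complete normed space at all rests on the order structure of the
  algebra: elements \<open>x*x\<close> are positive (\<open>positive_star_mult_self\<close>) and the norm is monotone on
  positive elements (\<open>norm_mono_positive\<close>). Both are obtained here without spectral theory or
  functional calculus, from square roots given by a convergent iteration.
\<close>

section \<open>Positive elements of a unital C*-algebra\<close>

lemma scaleC_zero_left: "scaleC 0 x = (0::'a::unital_cstar_algebra)"
  using scaleC_of_real[of 0 x] by simp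

lemma scaleC_minus_right: "scaleC c (- x) = - scaleC c (x::'a::unital_cstar_algebra)"
  using scaleC_mult_right[of "- x" c 1] scaleC_mult_right[of x c 1] by simp

lemma scaleC_minus_left: "scaleC (- c) x = - scaleC c (x::'a::unital_cstar_algebra)"
  using scaleC_add_left[of c "- c" x] by (simp add: scaleC_zero_left eq_neg_iff_add_eq_0 add.commute)

lemma scaleC_imaginary_unit_twice: "scaleC \<i> (scaleC \<i> x) = - (x::'a::unital_cstar_algebra)"
  using scaleC_of_real[of "-1" x] by (simp add: scaleC_scaleC)

lemma scaleC_diff_right: "scaleC c (x - y) = scaleC c x - scaleC c (y::'a::unital_cstar_algebra)"
  using scaleC_add_right[of c x "- y"] by (simp add: scaleC_minus_right)

lemma star_zero [simp]: "star 0 = (0::'a::unital_cstar_algebra)"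
  using star_scaleC[of 0 "0::'a"] by (simp add: scaleC_zero_left)

lemma star_minus: "star (- x) = - star (x::'a::unital_cstar_algebra)"
  using star_add[of "-x" x] by (simp add: eq_neg_iff_add_eq_0)

lemma star_diff: "star (x - y) = star x - star (y::'a::unital_cstar_algebra)"
  using star_add[of x "-y"] by (simp add: star_minus)

lemma star_scaleR: "star (r *\<^sub>R x) = r *\<^sub>R star (x::'a::unital_cstar_algebra)"
  using star_scaleC[of "complex_of_real r" x] by (simp add: scaleC_of_real)

lemma star_one [simp]: "star 1 = (1::'a::unital_cstar_algebra)"
  by (metis mult_1_left mult.right_neutral star_mult star_star)

lemma norm_star [simp]: "norm (star x) = norm (x::'a::unital_cstar_algebra)"
proof -
  have le: "norm y \<le> norm (star y)" for y :: 'a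
  proof (cases "y = 0")
    case False
    have "norm y * norm y \<le> norm (star y) * norm y"
      using norm_mult_ineq[of "star y" y] by (simp add: norm_star_mult_self power2_eq_square)
    then show ?thesis using False by simp
  qed simp
  show ?thesis using le[of x] le[of "star x"] by (simp add: star_star)
qed

lemma bounded_linear_star: "bounded_linear (star :: 'a::unital_cstar_algebra \<Rightarrow> 'a)"
  by (rule bounded_linear_intro[where K = 1]) (simp_all add: star_add star_scaleR)

lemma norm_one_le: "norm (1::'a::unital_cstar_algebra) \<le> 1"
proof -
  have "norm (1::'a) = (norm (1::'a))\<^sup>2"
    using norm_star_mult_self[of "1::'a"] by simp
  then have "norm (1::'a) = 0 \<or> norm (1::'a) = 1"
    by (metis mult_cancel_left1 power2_eq_square)
  then show ?thesis by auto
qed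

lemma norm_scaleR_one_le: "0 \<le> t \<Longrightarrow> norm (t *\<^sub>R (1::'a::unital_cstar_algebra)) \<le> t"
  using norm_one_le mult_left_le by (auto simp: mult_left_le)

lemma norm_selfadjoint_square:
  "star b = b \<Longrightarrow> norm (b * b) = (norm (b::'a::unital_cstar_algebra))\<^sup>2"
  using norm_star_mult_self[of b] by simp

lemma norm_selfadjoint_power:
  fixes b :: "'a::unital_cstar_algebra"
  assumes "star b = b"
  shows "norm (b ^ (2 ^ n)) = norm b ^ (2 ^ n)"
proof -
  have star_pow: "star (b ^ k) = b ^ k" for k
    by (induction k) (simp_all add: star_mult assms power_commutes)
  show ?thesis
  proof (induction n)
    case (Suc n)
    have "b ^ 2 ^ Suc n = b ^ (2 ^ n) * b ^ (2 ^ n)"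
      by (simp flip: power_add add: mult_2)
    then have "norm (b ^ 2 ^ Suc n) = (norm (b ^ 2 ^ n))\<^sup>2"
      using norm_selfadjoint_square[OF star_pow] by simp
    then show ?case
      by (simp add: Suc.IH power_mult[symmetric] mult.commute)
  qed simp
qed

text \<open>With \<open>u = b + ik\<close> one has \<open>u*u = b\<^sup>2 + k\<^sup>2\<close>, hence \<open>\<parallel>u\<parallel>\<^sup>2 \<le> c\<close>, and \<open>b\<close> is the real part
  of \<open>u\<close>. Norm bounds that usually come from the functional calculus are reduced to this one by
  exhibiting a suitable square root \<open>k\<close>.\<close>

lemma norm_le_of_sum_of_squares:
  fixes b k :: "'a::unital_cstar_algebra"
  assumes b: "star b = b" and k: "star k = k" and comm: "b * k = k * b"
    and sum: "b * b + k * k = c *\<^sub>R 1" and c: "0 \<le> c"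
  shows "(norm b)\<^sup>2 \<le> c"
proof -
  define u where "u = b + scaleC \<i> k"
  have su: "star u = b - scaleC \<i> k"
    by (simp add: u_def star_add star_scaleC scaleC_minus_left b k)
  have "star u * u = b * b + k * k"
    unfolding su by (simp add: u_def distrib_left left_diff_distrib scaleC_mult_left
      scaleC_mult_right scaleC_diff_right scaleC_imaginary_unit_twice comm)
  then have "(norm u)\<^sup>2 \<le> c"
    using norm_star_mult_self[of u] norm_scaleR_one_le[OF c, where ?'a = 'a] sum by simp
  moreover have "norm b \<le> norm u"
  proof -
    have "2 *\<^sub>R b = u + star u" unfolding su by (simp add: u_def scaleR_2)
    then have "2 * norm b = norm (u + star u)" by (metis abs_numeral norm_scaleR)
    also have "\<dots> \<le> norm u + norm u" using norm_triangle_ineq[of u "star u"] by simp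
    finally show ?thesis by simp
  qed
  ultimately show ?thesis
    by (meson norm_ge_zero order_trans power_mono)
qed

text \<open>The iteration \<open>y \<mapsto> (x + y\<^sup>2)/2\<close> has the fixed points \<open>1 - s\<close> with \<open>s\<^sup>2 = 1 - x\<close>.\<close>

primrec sqrt_iter :: "'a::unital_cstar_algebra \<Rightarrow> nat \<Rightarrow> 'a" where
  "sqrt_iter x 0 = 0"
| "sqrt_iter x (Suc n) = (1/2) *\<^sub>R (x + sqrt_iter x n * sqrt_iter x n)"

text \<open>The same iteration for the real number \<open>x = 1\<close>. It dominates the one in the algebra.\<close>

primrec sqrt_majorant :: "nat \<Rightarrow> real" where
  "sqrt_majorant 0 = 0"
| "sqrt_majorant (Suc n) = (1 + (sqrt_majorant n)\<^sup>2) / 2"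

lemma sqrt_majorant_bounds: "0 \<le> sqrt_majorant n \<and> sqrt_majorant n \<le> 1"
  by (induction n) (auto simp: power_le_one)

lemma sqrt_majorant_Suc: "sqrt_majorant n \<le> sqrt_majorant (Suc n)"
  using zero_le_power2[of "1 - sqrt_majorant n"] by (simp add: power2_eq_square algebra_simps)

lemma summable_sqrt_majorant_diff: "summable (\<lambda>n. sqrt_majorant (Suc n) - sqrt_majorant n)"
proof -
  have "convergent sqrt_majorant"
    using sqrt_majorant_bounds
    by (intro Bseq_mono_convergent)
       (auto intro!: BseqI'[where K = 1] lift_Suc_mono_le sqrt_majorant_Suc simp del: sqrt_majorant.simps)
  then show ?thesis
    unfolding convergent_def using telescope_summable by blast
qed

lemma norm_sqrt_iter:
  assumes "norm x \<le> 1"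
  shows "norm (sqrt_iter x n) \<le> sqrt_majorant n"
proof (induction n)
  case (Suc n)
  let ?y = "sqrt_iter x n"
  have "norm (?y * ?y) \<le> (norm ?y)\<^sup>2"
    by (simp add: power2_eq_square norm_mult_ineq)
  also have "\<dots> \<le> (sqrt_majorant n)\<^sup>2" by (rule power_mono[OF Suc]) simp
  finally have "norm (?y * ?y) \<le> (sqrt_majorant n)\<^sup>2" .
  then show ?case using assms norm_triangle_ineq[of x "?y * ?y"] by simp
qed simp

lemma norm_sqrt_iter_diff:
  assumes "norm x \<le> 1"
  shows "norm (sqrt_iter x (Suc n) - sqrt_iter x n) \<le> sqrt_majorant (Suc n) - sqrt_majorant n"
proof (induction n)
  case 0
  show ?case using assms by simp
next
  case (Suc n)
  define y z where "y = sqrt_iter x (Suc n)" and "z = sqrt_iter x n"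
  define r s where "r = sqrt_majorant (Suc n)" and "s = sqrt_majorant n"
  have eq: "y * y - z * z = y * (y - z) + (y - z) * z" by (simp add: algebra_simps)
  have y: "norm y \<le> r" and z: "norm z \<le> s" and yz: "norm (y - z) \<le> r - s"
    using norm_sqrt_iter[OF assms] Suc.IH unfolding y_def z_def r_def s_def by blast+
  have nonneg: "0 \<le> r" "0 \<le> s" using sqrt_majorant_bounds unfolding r_def s_def by blast+
  have n1: "norm (y * (y - z)) \<le> r * (r - s)"
    by (rule order_trans[OF norm_mult_ineq mult_mono[OF y yz]]) (simp_all add: nonneg)
  have n2: "norm ((y - z) * z) \<le> (r - s) * s"
    by (rule order_trans[OF norm_mult_ineq mult_mono[OF yz z]]) (use yz norm_ge_zero order_trans in \<open>blast, simp\<close>)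
  have "sqrt_iter x (Suc (Suc n)) = (1/2) *\<^sub>R (x + y * y)" unfolding y_def by (rule sqrt_iter.simps(2))
  moreover have "sqrt_iter x (Suc n) = (1/2) *\<^sub>R (x + z * z)" unfolding z_def by (rule sqrt_iter.simps(2))
  ultimately have "norm (sqrt_iter x (Suc (Suc n)) - sqrt_iter x (Suc n)) = norm ((1/2) *\<^sub>R (y * y - z * z))"
    by (metis add_diff_cancel_left scaleR_diff_right)
  also have "\<dots> \<le> (r * (r - s) + (r - s) * s) / 2"
    using norm_triangle_le[OF add_mono[OF n1 n2]] eq by simp
  also have "\<dots> = sqrt_majorant (Suc (Suc n)) - sqrt_majorant (Suc n)"
    unfolding sqrt_majorant.simps(2)[of "Suc n", folded r_def] r_def[symmetric]
    using sqrt_majorant.simps(2)[of n, folded r_def s_def]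
    by (simp add: power2_eq_square field_simps)
  finally show ?case .
qed

lemma commute_sqrt_iter: "z * x = x * z \<Longrightarrow> z * sqrt_iter x n = sqrt_iter x n * z"
proof (induction n)
  case (Suc n)
  have "z * (sqrt_iter x n * sqrt_iter x n) = sqrt_iter x n * sqrt_iter x n * z"
    using Suc by (metis mult.assoc)
  then show ?case using Suc.prems by (simp add: distrib_left distrib_right)
qed simp

lemma star_sqrt_iter: "star x = x \<Longrightarrow> star (sqrt_iter x n) = sqrt_iter x n"
  by (induction n) (simp_all add: star_scaleR star_add star_mult)

lemma sqrt_one_minus:
  fixes x :: "'a::unital_cstar_algebra"
  assumes "norm x \<le> 1" and sa: "star x = x"
  obtains s where "star s = s" "norm (1 - s) \<le> 1" "s * s = 1 - x"
    "\<And>z. z * x = x * z \<Longrightarrow> z * s = s * z"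
proof -
  have "summable (\<lambda>n. sqrt_iter x (Suc n) - sqrt_iter x n)"
    by (rule summable_comparison_test'[OF summable_sqrt_majorant_diff norm_sqrt_iter_diff[OF assms(1)]])
  then have "convergent (sqrt_iter x)"
    unfolding summable_iff_convergent by (simp only: sum_lessThan_telescope) simp
  then obtain y where y: "sqrt_iter x \<longlonglongrightarrow> y" unfolding convergent_def by blast
  have "(\<lambda>n. sqrt_iter x (Suc n)) \<longlonglongrightarrow> (1/2) *\<^sub>R (x + y * y)"
    unfolding sqrt_iter.simps by (intro tendsto_intros y)
  then have "y = (1/2) *\<^sub>R (x + y * y)"
    using LIMSEQ_unique LIMSEQ_Suc[OF y] by blast
  then have "2 *\<^sub>R y = x + y * y"
    by (metis scaleR_half_double scaleR_2 scaleR_add_right)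
  then have yy: "y * y = y + y - x" by (simp add: scaleR_2 algebra_simps)
  show ?thesis
  proof (rule that[of "1 - y"])
    have "(\<lambda>n. star (sqrt_iter x n)) \<longlonglongrightarrow> star y"
      by (rule bounded_linear.tendsto[OF bounded_linear_star y])
    then have "star y = y"
      using y LIMSEQ_unique by (simp add: star_sqrt_iter[OF sa]) blast
    then show "star (1 - y) = 1 - y" by (simp add: star_diff)
    have "norm (sqrt_iter x n) \<le> 1" for n
      using norm_sqrt_iter[OF assms(1)] sqrt_majorant_bounds order_trans by blast
    then have "norm y \<le> 1"
      by (intro LIMSEQ_le_const2[OF tendsto_norm[OF y]]) auto
    then show "norm (1 - (1 - y)) \<le> 1" by simp
    show "(1 - y) * (1 - y) = 1 - x" using yy by (simp add: algebra_simps)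
    fix z assume z: "z * x = x * z"
    have "(\<lambda>n. z * sqrt_iter x n) \<longlonglongrightarrow> z * y" "(\<lambda>n. sqrt_iter x n * z) \<longlonglongrightarrow> y * z"
      by (intro tendsto_intros y)+
    then have "z * y = y * z" using LIMSEQ_unique by (simp add: commute_sqrt_iter[OF z]) blast
    then show "z * (1 - y) = (1 - y) * z" by (simp add: algebra_simps)
  qed
qed

text \<open>For self-adjoint \<open>a\<close> the inequality places the spectrum in \<open>[0, 2t]\<close>. In this form
  sums of positive elements are visibly positive.\<close>

definition positive :: "'a::unital_cstar_algebra \<Rightarrow> bool" where
  "positive a \<longleftrightarrow> star a = a \<and> (\<exists>t. norm (t *\<^sub>R 1 - a) \<le> t)"

lemma positive_selfadjoint: "positive a \<Longrightarrow> star a = a"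
  by (simp add: positive_def)

lemma positive_zero [simp]: "positive 0"
  by (auto simp: positive_def intro: exI[of _ 0])

lemma positive_sqrt:
  assumes "positive a"
  obtains b where "positive b" "star b = b" "b * b = a" "\<And>z. z * a = a * z \<Longrightarrow> z * b = b * z"
proof -
  obtain t where sa: "star a = a" and t: "norm (t *\<^sub>R 1 - a) \<le> t"
    using assms by (auto simp: positive_def)
  have "0 \<le> t" using t norm_ge_zero order_trans by blast
  show ?thesis
  proof (cases "t = 0")
    case True
    then show ?thesis using t that[of 0] by simp
  next
    case False
    then have t0: "0 < t" using \<open>0 \<le> t\<close> by simp
    define x where "x = 1 - (1/t) *\<^sub>R a"
    have x_eq: "x = (1/t) *\<^sub>R (t *\<^sub>R 1 - a)" using t0 by (simp add: x_def scaleR_diff_right)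
    have "norm x = norm (t *\<^sub>R 1 - a) / t" unfolding x_eq norm_scaleR using t0 by simp
    then have "norm x \<le> 1" using t t0 by simp
    moreover have "star x = x" by (simp add: x_def star_diff star_scaleR sa)
    ultimately obtain s where pos: "norm (1 - s) \<le> 1"
      and s: "star s = s" "s * s = 1 - x" "\<And>z. z * x = x * z \<Longrightarrow> z * s = s * z"
      using sqrt_one_minus by blast
    show ?thesis
    proof (rule that[of "sqrt t *\<^sub>R s"])
      show sa': "star (sqrt t *\<^sub>R s) = sqrt t *\<^sub>R s" by (simp add: star_scaleR s)
      have "norm (sqrt t *\<^sub>R (1 - s)) \<le> sqrt t" using pos t0 by simp
      then show "positive (sqrt t *\<^sub>R s)"
        using sa' by (auto simp: positive_def scaleR_diff_right intro: exI[of _ "sqrt t"])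
      have "sqrt t *\<^sub>R s * sqrt t *\<^sub>R s = t *\<^sub>R (s * s)" using t0 by simp
      also have "\<dots> = a" using t0 by (simp add: s x_def)
      finally show "sqrt t *\<^sub>R s * sqrt t *\<^sub>R s = a" .
      fix z assume "z * a = a * z"
      then have "z * x = x * z" by (simp add: x_def algebra_simps)
      then have "z * s = s * z" by (rule s(3))
      then show "z * sqrt t *\<^sub>R s = sqrt t *\<^sub>R s * z" by simp
    qed
  qed
qed

text \<open>The case \<open>t = 1\<close> is typical. If \<open>k\<close> is a square root of \<open>1 - b\<^sup>2\<close>, then \<open>k\<^sup>2 + b\<^sup>2 = 1\<close> forces
  \<open>\<parallel>k\<parallel> \<le> 1\<close>, which is the bound on \<open>\<parallel>1 - b\<^sup>2\<parallel>\<close>.\<close>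

lemma square_bound:
  fixes b :: "'a::unital_cstar_algebra"
  assumes sa: "star b = b" and t: "(norm b)\<^sup>2 \<le> t"
  shows "norm (t *\<^sub>R 1 - b * b) \<le> t"
proof (cases "t = 0")
  case True
  then show ?thesis using t by simp
next
  case False
  then have t0: "0 < t" using t zero_le_power2[of "norm b"] by linarith
  define x where "x = (1/t) *\<^sub>R (b * b)"
  have "norm x \<le> 1" using t t0 norm_selfadjoint_square[OF sa] by (simp add: x_def field_simps)
  moreover have "star x = x" by (simp add: x_def star_scaleR star_mult sa)
  ultimately obtain k where k: "star k = k" "k * k = 1 - x" "\<And>z. z * x = x * z \<Longrightarrow> z * k = k * z"
    using sqrt_one_minus by blast
  define b' where "b' = (1 / sqrt t) *\<^sub>R b"
  have bk: "b * k = k * b" by (rule k(3)) (simp add: x_def mult.assoc)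
  have "(norm k)\<^sup>2 \<le> 1"
  proof (rule norm_le_of_sum_of_squares[where k = b'])
    show "star b' = b'" by (simp add: b'_def star_scaleR sa)
    show "k * b' = b' * k" by (simp add: b'_def bk)
    have "b' * b' = x" using t0 by (simp add: b'_def x_def)
    then show "k * k + b' * b' = 1 *\<^sub>R 1" by (simp add: k)
  qed (simp_all add: k(1))
  then have "norm (k * k) \<le> 1" using norm_selfadjoint_square[OF k(1)] by simp
  moreover have "t *\<^sub>R 1 - b * b = t *\<^sub>R (k * k)"
    using t0 by (simp add: k x_def scaleR_diff_right)
  ultimately show ?thesis using t0 by simp
qed

lemma positive_square: "star b = b \<Longrightarrow> positive (b * b)"
  using square_bound[of b "(norm b)\<^sup>2"] by (auto simp: positive_def star_mult)

text \<open>The parameter \<open>t\<close> in the definition of positivity may thus be any upper bound of the norm.\<close>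

lemma positive_norm_bound:
  assumes "positive a" "norm a \<le> t"
  shows "norm (t *\<^sub>R 1 - a) \<le> t"
proof -
  obtain b where "star b = b" "b * b = a" using positive_sqrt[OF assms(1)] by blast
  then show ?thesis using square_bound[of b t] norm_selfadjoint_square[of b] assms(2) by auto
qed

lemma positive_add:
  assumes "positive a" "positive b"
  shows "positive (a + b)"
proof -
  obtain s t where "norm (s *\<^sub>R 1 - a) \<le> s" "norm (t *\<^sub>R 1 - b) \<le> t"
    using assms by (auto simp: positive_def)
  then have "norm ((s *\<^sub>R 1 - a) + (t *\<^sub>R 1 - b)) \<le> s + t" by (meson add_mono norm_triangle_le)
  then have "norm ((s + t) *\<^sub>R 1 - (a + b)) \<le> s + t" by (simp add: algebra_simps)
  then show ?thesis using assms by (auto simp: positive_def star_add)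
qed

lemma positive_scaleR:
  assumes "positive a" "0 \<le> r"
  shows "positive (r *\<^sub>R a)"
proof -
  obtain b where b: "star b = b" "b * b = a" using positive_sqrt[OF assms(1)] by blast
  have "(sqrt r *\<^sub>R b) * (sqrt r *\<^sub>R b) = r *\<^sub>R a" using assms b by simp
  then show ?thesis using positive_square[of "sqrt r *\<^sub>R b"] b by (simp only: star_scaleR)
qed

lemma positive_sum: "(\<And>i. i \<in> I \<Longrightarrow> positive (f i)) \<Longrightarrow> positive (sum f I)"
  by (induction I rule: infinite_finite_induct) (auto intro: positive_add)

text \<open>If \<open>\<parallel>b\<parallel> = c\<close> then \<open>c - a = (c - b) + (b - a)\<close> is positive as well. The square roots of
  \<open>a\<close> and \<open>c - a\<close> commute, and their squares add up to \<open>c\<close>.\<close>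

lemma norm_mono_positive:
  assumes a: "positive a" and ba: "positive (b - a)"
  shows "norm a \<le> norm b"
proof -
  define c where "c = norm b"
  have b: "positive b" using positive_add[OF a ba] by simp
  have "positive (c *\<^sub>R 1 - b)"
    using positive_selfadjoint[OF b]
    by (auto simp: positive_def star_diff star_scaleR c_def intro!: exI[of _ "norm b"])
  then have "positive ((c *\<^sub>R 1 - b) + (b - a))" by (rule positive_add[OF _ ba])
  then have "positive (c *\<^sub>R 1 - a)" by simp
  then obtain k where k: "star k = k" "k * k = c *\<^sub>R 1 - a"
    "\<And>z. z * (c *\<^sub>R 1 - a) = (c *\<^sub>R 1 - a) * z \<Longrightarrow> z * k = k * z"
    using positive_sqrt by blast
  obtain r where r: "star r = r" "r * r = a" "\<And>z. z * a = a * z \<Longrightarrow> z * r = r * z"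
    using positive_sqrt[OF a] by blast
  have "a * k = k * a" by (rule k(3)) (simp add: algebra_simps)
  then have "k * r = r * k" by (intro r(3)) simp
  then have "(norm r)\<^sup>2 \<le> c"
    using r(1,2) k(1,2) by (intro norm_le_of_sum_of_squares[where k = k]) (simp_all add: c_def)
  then show ?thesis using norm_selfadjoint_square[OF r(1)] r(2) by (simp add: c_def)
qed

lemma positive_antisym: "positive a \<Longrightarrow> positive (- a) \<Longrightarrow> a = 0"
  using norm_mono_positive[of a 0] by simp

lemma root_growth_bound:
  fixes q :: real
  assumes "\<And>n. q ^ (2 ^ n) \<le> 2 ^ n + 1"
  shows "q \<le> 1"
proof (rule ccontr)
  assume "\<not> q \<le> 1"
  then have q: "1 < q" by simp
  obtain n where n: "1 < real n * (sqrt q - 1)\<^sup>2"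
    using reals_Archimedean3[of "(sqrt q - 1)\<^sup>2"] q by auto
  define m :: nat where "m = 2 ^ n"
  \<comment> \<open>Squaring Bernoulli's inequality for \<open>1 + d = sqrt q\<close> makes the lower bound on \<open>q\<^sup>m\<close> quadratic in \<open>m\<close>.\<close>
  define d where "d = sqrt q - 1"
  have d: "0 < d" using q by (simp add: d_def)
  have nm: "real n < real m" unfolding m_def using less_exp of_nat_less_iff by blast
  have "1 + real m * d \<le> (1 + d) ^ m" using Bernoulli_inequality[of d m] d by simp
  then have "(1 + real m * d)\<^sup>2 \<le> ((1 + d) ^ m)\<^sup>2" using d by (intro power_mono) auto
  also have "\<dots> = ((1 + d)\<^sup>2) ^ m" by (simp flip: power_mult add: mult.commute)
  also have "\<dots> = q ^ m" using q by (simp add: d_def)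
  also have "\<dots> \<le> m + 1" using assms[of n] by (simp add: m_def)
  finally have "(1 + real m * d)\<^sup>2 \<le> real m + 1" by simp
  then have "real m * (real m * d\<^sup>2) \<le> real m"
    using d by (simp add: power2_eq_square algebra_simps) (smt (verit) mult_nonneg_nonneg of_nat_0_le_iff)
  then have "real m * d\<^sup>2 \<le> 1" using nm by (simp add: mult_le_cancel_left1)
  moreover have "real n * d\<^sup>2 \<le> real m * d\<^sup>2" using nm by (intro mult_right_mono) auto
  ultimately show False using n d_def by simp
qed

text \<open>Passing from \<open>y*y\<close> to \<open>yy*\<close> is the usual coincidence of the nonzero spectra of
  \<open>ab\<close> and \<open>ba\<close>. Here it takes the form \<open>(t + yy*)\<^sup>m = t\<^sup>m + y g\<^sub>m y*\<close>, where \<open>g\<^sub>m\<close> is built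
  from the powers of \<open>t + y*y\<close>, and the norm of a self-adjoint element can be read off from
  its powers.\<close>

lemma positive_neg_swap:
  fixes y :: "'a::unital_cstar_algebra"
  assumes "positive (- (star y * y))"
  shows "positive (- (y * star y))"
proof (cases "y = 0")
  case False
  define t where "t = (norm y)\<^sup>2"
  have t0: "0 < t" using False by (simp add: t_def)
  define w where "w = t *\<^sub>R 1 + star y * y"
  define z where "z = t *\<^sub>R 1 + y * star y"
  define g where "g = rec_nat (0::'a) (\<lambda>m u. t ^ m *\<^sub>R 1 + u * w)"
  have g0: "g 0 = 0" and gS: "g (Suc m) = t ^ m *\<^sub>R 1 + g m * w" for m by (simp_all add: g_def)
  have w: "norm w \<le> t"
    using positive_norm_bound[OF assms, of t] by (simp add: w_def t_def norm_star_mult_self)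
  have sz: "star z = z" by (simp add: z_def star_add star_mult star_star star_scaleR)
  have wz: "star y * z = w * star y" by (simp add: w_def z_def algebra_simps)
  have zm: "z ^ m = t ^ m *\<^sub>R 1 + y * g m * star y" for m
  proof (induction m)
    case (Suc m)
    have "z ^ Suc m = (t ^ m *\<^sub>R 1 + y * g m * star y) * z"
      by (simp add: power_Suc2 flip: Suc.IH del: power_Suc)
    also have "\<dots> = t ^ m *\<^sub>R z + y * g m * (star y * z)" by (simp add: algebra_simps)
    also have "\<dots> = t ^ Suc m *\<^sub>R 1 + y * g (Suc m) * star y"
      unfolding wz by (simp add: gS z_def algebra_simps)
    finally show ?case .
  qed (simp add: g0)
  have gm: "norm (g m) * t \<le> m * t ^ m" for m
  proof (induction m)
    case (Suc m)
    have "norm (g (Suc m)) \<le> t ^ m + norm (g m) * t"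
      unfolding gS
    proof (intro norm_triangle_le add_mono)
      show "norm (t ^ m *\<^sub>R (1::'a)) \<le> t ^ m" using t0 by (intro norm_scaleR_one_le) simp
      show "norm (g m * w) \<le> norm (g m) * t"
        by (meson norm_mult_ineq mult_left_mono norm_ge_zero order_trans w)
    qed
    also have "\<dots> \<le> Suc m * t ^ m" using Suc.IH by (simp add: algebra_simps)
    finally have "norm (g (Suc m)) * t \<le> Suc m * t ^ m * t"
      using t0 by (intro mult_right_mono) auto
    then show ?case by (simp add: mult_ac)
  qed (simp add: g0)
  have zn: "norm (z ^ m) \<le> (m + 1) * t ^ m" for m
  proof -
    have "norm (y * g m * star y) \<le> norm y * norm (g m) * norm y"
      by (metis norm_mult_ineq norm_star mult_right_mono norm_ge_zero order_trans)
    then have "norm (y * g m * star y) \<le> m * t ^ m"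
      using gm[of m] by (simp add: t_def power2_eq_square mult.assoc mult.left_commute mult.commute)
    moreover have "norm (t ^ m *\<^sub>R (1::'a)) \<le> t ^ m" using t0 by (intro norm_scaleR_one_le) simp
    ultimately show ?thesis
      unfolding zm using norm_triangle_le[of "t ^ m *\<^sub>R 1" "y * g m * star y"]
      by (simp add: algebra_simps)
  qed
  have "norm z / t \<le> 1"
  proof (rule root_growth_bound)
    fix n
    have "norm z ^ 2 ^ n \<le> (2 ^ n + 1) * t ^ 2 ^ n"
      using zn[of "2 ^ n"] norm_selfadjoint_power[OF sz, of n] by simp
    then show "(norm z / t) ^ 2 ^ n \<le> 2 ^ n + 1"
      using t0 by (simp add: power_divide divide_le_eq)
  qed
  then have "norm z \<le> t" using t0 by simp
  then show ?thesis
    by (auto simp: positive_def z_def star_minus star_mult star_star intro!: exI[of _ t])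
qed simp

text \<open>If \<open>y = a + ib\<close>, then \<open>y*y + yy* = 2a\<^sup>2 + 2b\<^sup>2\<close> is positive. Since \<open>-yy*\<close> is positive too,
  so is their sum \<open>y*y\<close>.\<close>

lemma neg_star_mult_self_positive:
  fixes y :: "'a::unital_cstar_algebra"
  assumes "positive (- (star y * y))"
  shows "y = 0"
proof -
  define a where "a = (1/2) *\<^sub>R (y + star y)"
  define b where "b = (1/2) *\<^sub>R scaleC \<i> (star y - y)"
  have sa: "star a = a" by (simp add: a_def star_scaleR star_add star_star add.commute)
  have sb: "star b = b"
    using scaleC_minus_right[of "\<i>" "star y - y"]
    by (simp add: b_def star_scaleR star_scaleC star_diff star_star scaleC_minus_left)
  have "star y * y + y * star y = 2 *\<^sub>R (a * a) + 2 *\<^sub>R (b * b)"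
  proof -
    have half: "4 *\<^sub>R ((1/2) *\<^sub>R u * (1/2) *\<^sub>R u) = u * u" for u :: 'a by simp
    have bb: "b = scaleC \<i> ((1/2) *\<^sub>R (star y - y))"
      using scaleC_mult_right[of "(1/2) *\<^sub>R 1" \<i> "star y - y"] by (simp add: b_def)
    have "b * b = - ((1/2) *\<^sub>R (star y - y) * (1/2) *\<^sub>R (star y - y))"
      unfolding bb by (simp only: scaleC_mult_left scaleC_mult_right scaleC_imaginary_unit_twice)
    then have "4 *\<^sub>R (a * a + b * b) = (y + star y) * (y + star y) - (star y - y) * (star y - y)"
      using half[of "y + star y"] half[of "star y - y"]
      by (simp only: a_def scaleR_add_right scaleR_minus_right scaleR_diff_right add_uminus_conv_diff)
    also have "\<dots> = 2 *\<^sub>R (star y * y + y * star y)" by (simp add: algebra_simps scaleR_2)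
    finally have "2 *\<^sub>R (2 *\<^sub>R (a * a + b * b)) = 2 *\<^sub>R (star y * y + y * star y)" by simp
    then show ?thesis by (simp only: scaleR_cancel_left) (simp add: scaleR_add_right)
  qed
  then have "positive (star y * y + y * star y)"
    by (simp add: positive_add positive_scaleR positive_square sa sb)
  then have "positive (star y * y + y * star y + - (y * star y))"
    using positive_add positive_neg_swap[OF assms] by blast
  then have "star y * y = 0" using assms positive_antisym[of "star y * y"] by simp
  then show ?thesis using norm_star_mult_self[of y] by simp
qed

text \<open>Let \<open>q\<close> be the negative part of \<open>h = x*x\<close>. Then \<open>(xq)*(xq) = qhq = -q\<^sup>3\<close>, which forces
  \<open>xq = 0\<close> and hence \<open>q = 0\<close>. In the proof \<open>m\<close> is the absolute value of \<open>h\<close>, and its square root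
  \<open>b\<close> shows that \<open>q\<^sup>3 = qmq = (qb)\<^sup>2\<close> is positive.\<close>

theorem positive_star_mult_self:
  fixes x :: "'a::unital_cstar_algebra"
  shows "positive (star x * x)"
proof -
  define h where "h = star x * x"
  have h: "star h = h" by (simp add: h_def star_mult star_star)
  obtain m where m: "positive m" "m * m = h * h"
    "\<And>z. z * (h * h) = h * h * z \<Longrightarrow> z * m = m * z"
    using positive_sqrt[OF positive_square[OF h]] by metis
  obtain b where b: "star b = b" "b * b = m" "\<And>z. z * m = m * z \<Longrightarrow> z * b = b * z"
    using positive_sqrt[OF m(1)] by metis
  have hm: "h * m = m * h" by (rule m(3)) (simp add: mult.assoc)
  have hb: "h * b = b * h" by (rule b(3)[OF hm])
  define q where "q = (1/2) *\<^sub>R (m - h)"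
  have sq: "star q = q" by (simp add: q_def star_scaleR star_diff h positive_selfadjoint m(1))
  have "b * m = m * b" using b(2) by (metis mult.assoc)
  then have qb: "q * b = b * q" by (simp add: q_def left_diff_distrib right_diff_distrib hb)
  have "q * (h + m) = 0" by (simp add: q_def algebra_simps hm m(2))
  then have qh: "q * h = - (q * m)" by (simp add: distrib_left eq_neg_iff_add_eq_0)
  have sqb: "star (q * b) = q * b" by (simp add: star_mult sq b(1) qb)
  have "star (x * q) * (x * q) = q * h * q" by (simp add: star_mult sq h_def mult.assoc)
  also have "\<dots> = - (q * b * (q * b))" by (simp add: qh flip: b(2)) (metis mult.assoc qb)
  finally have y: "star (x * q) * (x * q) = - (q * b * (q * b))" .
  then have "positive (- (star (x * q) * (x * q)))" using positive_square[OF sqb] by (simp only: minus_minus)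
  then have "x * q = 0" by (rule neg_star_mult_self_positive)
  then have "q * b * (q * b) = 0" using y by simp
  then have "q * b = 0" using norm_selfadjoint_square[OF sqb] by simp
  then have "q * m = 0" by (simp flip: b(2) mult.assoc)
  then have "q * q = 0" using qh by (simp add: q_def right_diff_distrib)
  then have "q = 0" using norm_selfadjoint_square[OF sq] by simp
  then show ?thesis using m(1) by (simp add: q_def h_def)
qed

section \<open>The standard module as a complete metric space\<close>

text \<open>The seminorms of the finite sections, whose supremum and limit is the norm of the standard module.\<close>

definition section_norm :: "nat set \<Rightarrow> (nat \<Rightarrow> 'a::unital_cstar_algebra) \<Rightarrow> real" where
  "section_norm I x = sqrt (norm (\<Sum>i\<in>I. star (x i) * x i))"

lemma section_norm_nonneg [simp]: "0 \<le> section_norm I x"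
  by (simp add: section_norm_def)

lemma section_norm_square: "(section_norm I x)\<^sup>2 = norm (\<Sum>i\<in>I. star (x i) * x i)"
  by (simp add: section_norm_def)

lemma section_norm_singleton: "section_norm {i} x = norm (x i)"
  by (simp add: section_norm_def norm_star_mult_self)

lemma section_norm_mono:
  assumes "finite J" "I \<subseteq> J"
  shows "section_norm I x \<le> section_norm J x"
proof -
  have "(\<Sum>i\<in>J. star (x i) * x i) - (\<Sum>i\<in>I. star (x i) * x i) = (\<Sum>i\<in>J - I. star (x i) * x i)"
    using assms by (simp add: sum_diff)
  then have "positive ((\<Sum>i\<in>J. star (x i) * x i) - (\<Sum>i\<in>I. star (x i) * x i))"
    by (simp only: positive_sum positive_star_mult_self)
  then show ?thesis
    unfolding section_norm_def
    by (intro real_sqrt_le_mono norm_mono_positive positive_sum positive_star_mult_self)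
qed

lemma positive_weighted_parallelogram:
  fixes x y :: "'a::unital_cstar_algebra"
  assumes "0 < l"
  shows "positive ((1 + l) *\<^sub>R (star x * x) + (1 + 1 / l) *\<^sub>R (star y * y) - star (x + y) * (x + y))"
proof -
  define w where "w = sqrt l *\<^sub>R x - (1 / sqrt l) *\<^sub>R y"
  have "star w * w = l *\<^sub>R (star x * x) - star x * y - star y * x + (1 / l) *\<^sub>R (star y * y)"
    using assms by (simp add: w_def star_diff star_scaleR left_diff_distrib right_diff_distrib
      scaleR_diff_right)
  then have "(1 + l) *\<^sub>R (star x * x) + (1 + 1 / l) *\<^sub>R (star y * y) - star (x + y) * (x + y) = star w * w"
    by (simp add: star_add scaleR_add_left distrib_left distrib_right)
  then show ?thesis by (simp add: positive_star_mult_self)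
qed

text \<open>Minimising the bound \<open>(1 + l) \<parallel>x\<parallel>\<^sup>2 + (1 + 1/l) \<parallel>y\<parallel>\<^sup>2\<close> over \<open>l\<close> gives \<open>(\<parallel>x\<parallel> + \<parallel>y\<parallel>)\<^sup>2\<close>,
  with minimum at \<open>l = \<parallel>y\<parallel> / \<parallel>x\<parallel>\<close>. The \<open>e\<close> keeps this quotient defined and positive.\<close>

lemma section_norm_triangle:
  "section_norm I (x + y) \<le> section_norm I x + section_norm I y"
proof (rule field_le_epsilon)
  fix e :: real assume "0 < e"
  define a b where "a = section_norm I x + e / 2" and "b = section_norm I y + e / 2"
  have ab: "0 < a" "0 < b" using \<open>0 < e\<close> by (simp_all add: a_def b_def add_nonneg_pos)
  define l where "l = b / a"
  have l: "0 < l" using ab by (simp add: l_def)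
  define X where "X = (\<Sum>i\<in>I. star (x i) * x i)"
  define Y where "Y = (\<Sum>i\<in>I. star (y i) * y i)"
  define Z where "Z = (\<Sum>i\<in>I. star ((x + y) i) * (x + y) i)"
  have "(1 + l) *\<^sub>R X + (1 + 1 / l) *\<^sub>R Y - Z =
    (\<Sum>i\<in>I. (1 + l) *\<^sub>R (star (x i) * x i) + (1 + 1 / l) *\<^sub>R (star (y i) * y i)
      - star (x i + y i) * (x i + y i))"
    by (simp only: X_def Y_def Z_def scaleR_sum_right sum.distrib sum_subtractf plus_fun_apply)
  then have "positive ((1 + l) *\<^sub>R X + (1 + 1 / l) *\<^sub>R Y - Z)"
    by (simp only: positive_sum[OF positive_weighted_parallelogram[OF l]])
  then have "norm Z \<le> norm ((1 + l) *\<^sub>R X + (1 + 1 / l) *\<^sub>R Y)"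
    by (intro norm_mono_positive) (auto simp: Z_def intro!: positive_sum positive_star_mult_self)
  also have "\<dots> \<le> (1 + l) * norm X + (1 + 1 / l) * norm Y"
    using l by (intro norm_triangle_le) simp
  also have "\<dots> \<le> (1 + l) * a\<^sup>2 + (1 + 1 / l) * b\<^sup>2"
  proof -
    have "norm X \<le> a\<^sup>2" "norm Y \<le> b\<^sup>2"
      unfolding X_def Y_def section_norm_square[symmetric]
      using \<open>0 < e\<close> by (auto simp: a_def b_def intro: power_mono)
    then show ?thesis using l by (intro add_mono mult_left_mono) auto
  qed
  also have "\<dots> = (a + b)\<^sup>2"
    using ab by (simp add: l_def field_simps power2_eq_square)
  finally have "norm Z \<le> (a + b)\<^sup>2" .
  then have "section_norm I (x + y) \<le> a + b"
    using ab by (simp add: section_norm_def Z_def[symmetric] real_le_lsqrt del: plus_fun_apply)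
  then show "section_norm I (x + y) \<le> section_norm I x + section_norm I y + e"
    by (simp add: a_def b_def)
qed

lemma HA_iff_section_norm:
  "x \<in> HA \<longleftrightarrow> (\<forall>e>0. \<exists>N. \<forall>m\<ge>N. \<forall>n. section_norm {m..<n} x < e)"
proof
  assume "x \<in> HA"
  then have *: "\<exists>N. \<forall>m\<ge>N. \<forall>n. norm (\<Sum>i\<in>{m..<n}. star (x i) * x i) < e" if "0 < e" for e
    using that by (simp add: HA_def summable_Cauchy)
  show "\<forall>e>0. \<exists>N. \<forall>m\<ge>N. \<forall>n. section_norm {m..<n} x < e"
  proof (intro allI impI)
    fix e :: real assume e: "0 < e"
    then obtain N where N: "\<And>m n. N \<le> m \<Longrightarrow> norm (\<Sum>i\<in>{m..<n}. star (x i) * x i) < e\<^sup>2"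
      using *[of "e\<^sup>2"] by auto
    show "\<exists>N. \<forall>m\<ge>N. \<forall>n. section_norm {m..<n} x < e"
      using N e by (intro exI[of _ N]) (simp add: section_norm_def real_less_lsqrt)
  qed
next
  assume *: "\<forall>e>0. \<exists>N. \<forall>m\<ge>N. \<forall>n. section_norm {m..<n} x < e"
  show "x \<in> HA"
    unfolding HA_def mem_Collect_eq summable_Cauchy
  proof (intro allI impI)
    fix e :: real assume "0 < e"
    then obtain N where N: "\<And>m n. N \<le> m \<Longrightarrow> section_norm {m..<n} x < sqrt e"
      using * real_sqrt_gt_zero by blast
    then show "\<exists>N. \<forall>m\<ge>N. \<forall>n. norm (\<Sum>i\<in>{m..<n}. star (x i) * x i) < e"
      by (intro exI[of _ N]) (simp add: section_norm_def)
  qed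
qed

lemma section_norm_tendsto_HA_norm:
  assumes "x \<in> HA"
  shows "(\<lambda>n. section_norm {..<n} x) \<longlonglongrightarrow> HA_norm x"
  using assms unfolding HA_def HA_norm_def HA_inner_def section_norm_def
  by (auto intro!: tendsto_real_sqrt tendsto_norm summable_LIMSEQ)

lemma section_norm_le_HA_norm:
  assumes "x \<in> HA" "finite I"
  shows "section_norm I x \<le> HA_norm x"
proof (rule LIMSEQ_le_const[OF section_norm_tendsto_HA_norm[OF assms(1)]])
  obtain k where "I \<subseteq> {..<k}" using assms(2) finite_nat_iff_bounded by blast
  then have "section_norm I x \<le> section_norm {..<n} x" if "k \<le> n" for n
    using that by (intro section_norm_mono) auto
  then show "\<exists>N. \<forall>n\<ge>N. section_norm I x \<le> section_norm {..<n} x" by blast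
qed

lemma norm_coordinate_le: "x \<in> HA \<Longrightarrow> norm (x i) \<le> HA_norm x"
  using section_norm_le_HA_norm[of x "{i}"] by (simp add: section_norm_singleton)

lemma HA_zero [simp]: "0 \<in> HA"
  by (simp add: HA_def)

lemma HA_add: "x \<in> HA \<Longrightarrow> y \<in> HA \<Longrightarrow> x + y \<in> HA"
  unfolding HA_iff_section_norm
proof (intro allI impI)
  fix e :: real
  assume x: "\<forall>e>0. \<exists>N. \<forall>m\<ge>N. \<forall>n. section_norm {m..<n} x < e"
    and y: "\<forall>e>0. \<exists>N. \<forall>m\<ge>N. \<forall>n. section_norm {m..<n} y < e" and "0 < e"
  then have "0 < e / 2" by simp
  then obtain N1 N2 where "\<And>m n. N1 \<le> m \<Longrightarrow> section_norm {m..<n} x < e / 2"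
    "\<And>m n. N2 \<le> m \<Longrightarrow> section_norm {m..<n} y < e / 2" using x y by blast
  then have "section_norm {m..<n} (x + y) < e" if "max N1 N2 \<le> m" for m n
    using that section_norm_triangle[of "{m..<n}" x y] by (smt (verit) field_sum_of_halves max.bounded_iff)
  then show "\<exists>N. \<forall>m\<ge>N. \<forall>n. section_norm {m..<n} (x + y) < e" by blast
qed

lemma HA_right_act: "x \<in> HA \<Longrightarrow> right_act x a \<in> HA"
  and HA_inner_right_act: "x \<in> HA \<Longrightarrow> HA_inner (right_act x a) (right_act x a) = star a * HA_inner x x * a"
proof -
  assume "x \<in> HA"
  then have s: "(\<lambda>n. star (x n) * x n) sums HA_inner x x"
    by (simp add: HA_def HA_inner_def summable_sums)
  have "(\<lambda>n. star a * (star (x n) * x n) * a) sums (star a * HA_inner x x * a)"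
    by (intro sums_mult2 sums_mult s)
  then have *: "(\<lambda>n. star (right_act x a n) * right_act x a n) sums (star a * HA_inner x x * a)"
    by (simp add: right_act_def star_mult mult.assoc)
  show "right_act x a \<in> HA" using * by (auto simp: HA_def summable_def)
  show "HA_inner (right_act x a) (right_act x a) = star a * HA_inner x x * a"
    using sums_unique[OF *] by (simp add: HA_inner_def)
qed

lemma HA_norm_nonneg [simp]: "0 \<le> HA_norm x"
  by (simp add: HA_norm_def)

lemma HA_norm_right_act:
  assumes "x \<in> HA"
  shows "HA_norm (right_act x a) \<le> norm a * HA_norm x"
proof -
  have "norm (star a * HA_inner x x * a) \<le> norm a * norm (HA_inner x x) * norm a"
    using order_trans[OF norm_mult_ineq mult_right_mono[OF norm_mult_ineq norm_ge_zero],
        of "star a" "HA_inner x x" a] by simp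
  then have "HA_norm (right_act x a) \<le> sqrt ((norm a)\<^sup>2 * norm (HA_inner x x))"
    unfolding HA_norm_def HA_inner_right_act[OF assms]
    by (intro real_sqrt_le_mono) (simp add: power2_eq_square mult_ac)
  then show ?thesis by (simp add: HA_norm_def real_sqrt_mult)
qed

lemma HA_norm_scaleR: "x \<in> HA \<Longrightarrow> HA_norm (right_act x (r *\<^sub>R 1)) \<le> \<bar>r\<bar> * HA_norm x"
  by (rule order_trans[OF HA_norm_right_act mult_right_mono]) (simp_all add: norm_one_le mult_left_le)

lemma right_act_minus_one: "right_act x (- 1) = - x"
  by (simp add: right_act_def fun_eq_iff)

lemma right_act_zero [simp]: "right_act 0 a = 0"
  by (simp add: right_act_def fun_eq_iff)

lemma right_act_by_zero [simp]: "right_act x 0 = 0"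
  by (simp add: right_act_def fun_eq_iff)

lemma right_act_add: "right_act (x + y) a = right_act x a + right_act y a"
  by (simp add: right_act_def fun_eq_iff distrib_right)

lemma right_act_diff: "right_act (x - y) a = right_act x a - right_act y a"
  by (simp add: right_act_def fun_eq_iff left_diff_distrib)

lemma right_act_add_right: "right_act x (a + b) = right_act x a + right_act x b"
  by (simp add: right_act_def fun_eq_iff distrib_left)

lemma right_act_right_act: "right_act (right_act x a) b = right_act x (a * b)"
  by (simp add: right_act_def fun_eq_iff mult.assoc)

lemma HA_minus: "x \<in> HA \<Longrightarrow> - x \<in> HA"
  using HA_right_act[of x "- 1"] by (simp only: right_act_minus_one)

lemma HA_diff: "x \<in> HA \<Longrightarrow> y \<in> HA \<Longrightarrow> x - y \<in> HA"
  using HA_add[of x "- y"] HA_minus[of y] by simp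

lemma HA_norm_minus [simp]: "HA_norm (- x) = HA_norm x"
  by (simp add: HA_norm_def HA_inner_def star_minus)

lemma HA_norm_minus_commute: "HA_norm (x - y) = HA_norm (y - x)"
  using HA_norm_minus[of "x - y"] by simp

lemma HA_norm_zero [simp]: "HA_norm 0 = 0"
  by (simp add: HA_norm_def HA_inner_def)

lemma HA_norm_eq_zeroD: "x \<in> HA \<Longrightarrow> HA_norm x = 0 \<Longrightarrow> x = 0"
  using norm_coordinate_le[of x] by (auto simp: fun_eq_iff)

lemma HA_norm_triangle:
  assumes "x \<in> HA" "y \<in> HA"
  shows "HA_norm (x + y) \<le> HA_norm x + HA_norm y"
proof (rule LIMSEQ_le[OF section_norm_tendsto_HA_norm[OF HA_add[OF assms]]])
  show "(\<lambda>n. section_norm {..<n} x + section_norm {..<n} y) \<longlonglongrightarrow> HA_norm x + HA_norm y"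
    by (intro tendsto_add section_norm_tendsto_HA_norm assms)
qed (use section_norm_triangle in blast)

lemma HA_norm_triangle_diff:
  assumes "x \<in> HA" "y \<in> HA" "z \<in> HA"
  shows "HA_norm (x - z) \<le> HA_norm (x - y) + HA_norm (y - z)"
  using HA_norm_triangle[OF HA_diff[OF assms(1,2)] HA_diff[OF assms(2,3)]] by simp

lemma HA_limit_unique:
  assumes X: "\<And>n. X n \<in> HA" and l: "l \<in> HA" "l' \<in> HA"
    and "(\<lambda>n. HA_norm (X n - l)) \<longlonglongrightarrow> 0" "(\<lambda>n. HA_norm (X n - l')) \<longlonglongrightarrow> 0"
  shows "l = l'"
proof -
  have "HA_norm (l - l') \<le> HA_norm (X n - l) + HA_norm (X n - l')" for n
    using HA_norm_triangle_diff[OF l(1) X[of n] l(2)] HA_norm_minus_commute[of l "X n"] by simp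
  then have "HA_norm (l - l') \<le> 0 + 0"
    by (intro LIMSEQ_le_const[OF tendsto_add[OF assms(4,5)]]) auto
  then show ?thesis using HA_norm_eq_zeroD[OF HA_diff[OF l]] by (simp add: order_antisym)
qed

text \<open>The limit is formed in each coordinate. On finite sections it may be passed through the
  seminorms, which gives bounds uniform in the section.\<close>

lemma HA_complete:
  assumes X: "\<And>n. X n \<in> HA"
    and Cauchy: "\<And>e. 0 < e \<Longrightarrow> \<exists>N. \<forall>m\<ge>N. \<forall>n\<ge>N. HA_norm (X m - X n) < e"
  shows "\<exists>l\<in>HA. (\<lambda>n. HA_norm (X n - l)) \<longlonglongrightarrow> 0"
proof -
  have "Cauchy (\<lambda>n. X n i)" for i
    unfolding Cauchy_iff
  proof (intro allI impI)
    fix e :: real assume "0 < e"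
    then obtain N where "\<And>m n. N \<le> m \<Longrightarrow> N \<le> n \<Longrightarrow> HA_norm (X m - X n) < e"
      using Cauchy by blast
    moreover have "norm (X m i - X n i) \<le> HA_norm (X m - X n)" for m n
      using norm_coordinate_le[OF HA_diff[OF X X]] by fastforce
    ultimately show "\<exists>M. \<forall>m\<ge>M. \<forall>n\<ge>M. norm (X m i - X n i) < e"
      by (meson order_le_less_trans)
  qed
  then have "\<exists>l. (\<lambda>n. X n i) \<longlonglongrightarrow> l" for i
    using Cauchy_convergent convergent_def by blast
  then obtain l where l: "\<And>i. (\<lambda>n. X n i) \<longlonglongrightarrow> l i" by metis
  have lim: "(\<lambda>n. section_norm I (X k - X n)) \<longlonglongrightarrow> section_norm I (X k - l)" for I k
    unfolding section_norm_def minus_apply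
    by (intro tendsto_real_sqrt tendsto_norm tendsto_sum tendsto_mult tendsto_diff tendsto_const l
        bounded_linear.tendsto[OF bounded_linear_star])
  have close: "\<exists>N. \<forall>k\<ge>N. \<forall>I. finite I \<longrightarrow> section_norm I (X k - l) \<le> e" if "0 < e" for e
  proof -
    obtain N where N: "\<And>m n. N \<le> m \<Longrightarrow> N \<le> n \<Longrightarrow> HA_norm (X m - X n) < e"
      using Cauchy[OF \<open>0 < e\<close>] by blast
    have "section_norm I (X k - l) \<le> e" if "N \<le> k" "finite I" for k I
    proof (rule LIMSEQ_le_const2[OF lim])
      show "\<exists>M. \<forall>n\<ge>M. section_norm I (X k - X n) \<le> e"
        using N[OF \<open>N \<le> k\<close>] section_norm_le_HA_norm[OF HA_diff[OF X X] \<open>finite I\<close>]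
        by (meson less_imp_le order_trans)
    qed
    then show ?thesis by blast
  qed
  have sym: "section_norm I (l - X k) = section_norm I (X k - l)" for I k
    by (simp add: section_norm_def star_diff algebra_simps)
  have "l \<in> HA"
    unfolding HA_iff_section_norm
  proof (intro allI impI)
    fix e :: real assume e: "0 < e"
    then obtain k where k: "\<And>I. finite I \<Longrightarrow> section_norm I (X k - l) \<le> e / 2"
      using close[of "e / 2"] by auto
    obtain N where N: "\<And>m n. N \<le> m \<Longrightarrow> section_norm {m..<n} (X k) < e / 2"
      using X[of k] e unfolding HA_iff_section_norm by (meson half_gt_zero)
    have "section_norm {m..<n} l < e" if "N \<le> m" for m n
    proof -
      have "section_norm {m..<n} (X k + (l - X k)) < e / 2 + e / 2"
        by (rule order_le_less_trans[OF section_norm_triangle])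
           (use k[of "{m..<n}"] N[OF that, of n] in \<open>simp add: sym\<close>)
      then show ?thesis by simp
    qed
    then show "\<exists>N. \<forall>m\<ge>N. \<forall>n. section_norm {m..<n} l < e" by blast
  qed
  moreover have "(\<lambda>n. HA_norm (X n - l)) \<longlonglongrightarrow> 0"
  proof (rule LIMSEQ_I)
    fix e :: real assume "0 < e"
    then obtain N where N: "\<And>k I. N \<le> k \<Longrightarrow> finite I \<Longrightarrow> section_norm I (X k - l) \<le> e / 2"
      using close[of "e / 2"] by auto
    have "HA_norm (X k - l) \<le> e / 2" if "N \<le> k" for k
      by (rule LIMSEQ_le_const2[OF section_norm_tendsto_HA_norm[OF HA_diff[OF X \<open>l \<in> HA\<close>]]])
         (use N that in blast)
    then show "\<exists>N. \<forall>n\<ge>N. norm (HA_norm (X n - l) - 0) < e"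
      using \<open>0 < e\<close> by (intro exI[of _ N]) fastforce
  qed
  ultimately show ?thesis by blast
qed

interpretation HA: Metric_space "HA :: (nat \<Rightarrow> 'a::unital_cstar_algebra) set" "\<lambda>x y. HA_norm (x - y)"
proof
  fix x y z :: "nat \<Rightarrow> 'a"
  show "HA_norm (x - y) = HA_norm (y - x)" by (rule HA_norm_minus_commute)
  show "HA_norm (x - y) = 0 \<longleftrightarrow> x = y" if "x \<in> HA" "y \<in> HA"
    using that HA_norm_eq_zeroD[OF HA_diff] by auto
  show "HA_norm (x - z) \<le> HA_norm (x - y) + HA_norm (y - z)" if "x \<in> HA" "y \<in> HA" "z \<in> HA"
    using that by (rule HA_norm_triangle_diff)
qed simp

lemma HA_limitin:
  "limitin HA.mtopology X l sequentially \<longleftrightarrow>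
    l \<in> HA \<and> (\<forall>\<^sub>F n in sequentially. X n \<in> HA) \<and> (\<lambda>n. HA_norm (X n - l)) \<longlonglongrightarrow> 0"
  by (rule HA.limitin_metric_dist_null)

lemma HA_mcomplete: "HA.mcomplete TYPE('a::unital_cstar_algebra)"
  unfolding HA.mcomplete_def HA_limitin
proof (intro allI impI)
  fix X :: "nat \<Rightarrow> nat \<Rightarrow> 'a"
  assume "HA.MCauchy X"
  then have range: "range X \<subseteq> HA"
    and Cauchy: "\<forall>e>0. \<exists>N. \<forall>m n. N \<le> m \<longrightarrow> N \<le> n \<longrightarrow> HA_norm (X m - X n) < e"
    by (simp_all add: HA.MCauchy_def)
  have X: "X n \<in> HA" for n using range by auto
  have "\<exists>l\<in>HA. (\<lambda>n. HA_norm (X n - l)) \<longlonglongrightarrow> 0"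
    by (rule HA_complete[OF X]) (use Cauchy in simp)
  then show "\<exists>l. l \<in> HA \<and> (\<forall>\<^sub>F n in sequentially. X n \<in> HA) \<and> (\<lambda>n. HA_norm (X n - l)) \<longlonglongrightarrow> 0"
    using X by auto
qed

section \<open>Bounded module maps and idempotents\<close>

lemma submodule_HA: "submodule M \<Longrightarrow> x \<in> M \<Longrightarrow> x \<in> HA"
  and submodule_zero: "submodule M \<Longrightarrow> 0 \<in> M"
  and submodule_add: "submodule M \<Longrightarrow> x \<in> M \<Longrightarrow> y \<in> M \<Longrightarrow> x + y \<in> M"
  and submodule_right_act: "submodule M \<Longrightarrow> x \<in> M \<Longrightarrow> right_act x a \<in> M"
  by (auto simp: submodule_def)

lemma submodule_minus: "submodule M \<Longrightarrow> x \<in> M \<Longrightarrow> - x \<in> M"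
  using submodule_right_act[of M x "- 1"] by (simp only: right_act_minus_one)

lemma submodule_diff: "submodule M \<Longrightarrow> x \<in> M \<Longrightarrow> y \<in> M \<Longrightarrow> x - y \<in> M"
  using submodule_add[of M x "- y"] submodule_minus[of M y] by simp

lemma submodule_sum: "submodule M \<Longrightarrow> (\<And>i. i \<in> I \<Longrightarrow> f i \<in> M) \<Longrightarrow> sum f I \<in> M"
  by (induction I rule: infinite_finite_induct) (auto intro: submodule_zero submodule_add)

lemma submodule_whole: "submodule HA"
  by (simp add: submodule_def HA_add HA_right_act)

lemma closed_submodule_submodule: "closed_submodule M \<Longrightarrow> submodule M"
  by (simp add: closed_submodule_def)

lemma closed_submodule_limit:
  "closed_submodule M \<Longrightarrow> l \<in> HA \<Longrightarrow> (\<And>k. X k \<in> M) \<Longrightarrow> (\<lambda>k. HA_norm (X k - l)) \<longlonglongrightarrow> 0 \<Longrightarrow> l \<in> M"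
  by (auto simp: closed_submodule_def)

lemma bounded_mapsI:
  assumes "\<And>x. x \<in> M \<Longrightarrow> T x \<in> N"
    and "\<And>x y. x \<in> M \<Longrightarrow> y \<in> M \<Longrightarrow> T (x + y) = T x + T y"
    and "\<And>x a. x \<in> M \<Longrightarrow> T (right_act x a) = right_act (T x) a"
    and "\<And>x. x \<in> M \<Longrightarrow> HA_norm (T x) \<le> C * HA_norm x"
  shows "T \<in> bounded_maps M N"
  using assms unfolding bounded_maps_def by blast

lemma bounded_maps_in: "T \<in> bounded_maps M N \<Longrightarrow> x \<in> M \<Longrightarrow> T x \<in> N"
  and bounded_maps_add: "T \<in> bounded_maps M N \<Longrightarrow> x \<in> M \<Longrightarrow> y \<in> M \<Longrightarrow> T (x + y) = T x + T y"
  and bounded_maps_right_act: "T \<in> bounded_maps M N \<Longrightarrow> x \<in> M \<Longrightarrow> T (right_act x a) = right_act (T x) a"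
  by (auto simp: bounded_maps_def)

lemma bounded_maps_bound:
  assumes "T \<in> bounded_maps M N"
  obtains C where "0 \<le> C" "\<And>x. x \<in> M \<Longrightarrow> HA_norm (T x) \<le> C * HA_norm x"
proof -
  obtain C where C: "\<And>x. x \<in> M \<Longrightarrow> HA_norm (T x) \<le> C * HA_norm x"
    using assms unfolding bounded_maps_def by blast
  have "HA_norm (T x) \<le> \<bar>C\<bar> * HA_norm x" if "x \<in> M" for x
    by (rule order_trans[OF C[OF that] mult_right_mono]) simp_all
  then show ?thesis using that[of "\<bar>C\<bar>"] by simp
qed

lemma bounded_maps_restrict:
  assumes "T \<in> bounded_maps M N" "M' \<subseteq> M" "\<And>x. x \<in> M' \<Longrightarrow> T x \<in> N'"
  shows "T \<in> bounded_maps M' N'"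
  using assms unfolding bounded_maps_def by blast

lemma bounded_maps_comp:
  assumes T: "T \<in> bounded_maps M N" and S: "S \<in> bounded_maps N K"
  shows "(\<lambda>x. S (T x)) \<in> bounded_maps M K"
proof -
  obtain C where C: "0 \<le> C" "\<And>x. x \<in> M \<Longrightarrow> HA_norm (T x) \<le> C * HA_norm x"
    using bounded_maps_bound[OF T] by blast
  obtain D where D: "0 \<le> D" "\<And>x. x \<in> N \<Longrightarrow> HA_norm (S x) \<le> D * HA_norm x"
    using bounded_maps_bound[OF S] by blast
  have in': "T x \<in> N" if "x \<in> M" for x using bounded_maps_in[OF T that] .
  show ?thesis
  proof (rule bounded_mapsI[where C = "D * C"])
    fix x assume x: "x \<in> M"
    have "HA_norm (S (T x)) \<le> D * (C * HA_norm x)"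
      by (rule order_trans[OF D(2)[OF in'[OF x]] mult_left_mono[OF C(2)[OF x] D(1)]])
    then show "HA_norm (S (T x)) \<le> D * C * HA_norm x" by (simp add: mult.assoc)
  qed (simp_all add: in' bounded_maps_in[OF S] bounded_maps_add[OF T] bounded_maps_add[OF S]
      bounded_maps_right_act[OF T] bounded_maps_right_act[OF S])
qed

lemma bounded_ops_diff:
  assumes T: "T \<in> bounded_ops HA" and S: "S \<in> bounded_ops HA"
  shows "(\<lambda>x. T x - S x) \<in> bounded_ops HA"
proof -
  obtain C where C: "\<And>x. x \<in> HA \<Longrightarrow> HA_norm (T x) \<le> C * HA_norm x"
    using bounded_maps_bound[OF T] by blast
  obtain D where D: "\<And>x. x \<in> HA \<Longrightarrow> HA_norm (S x) \<le> D * HA_norm x"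
    using bounded_maps_bound[OF S] by blast
  show ?thesis
  proof (rule bounded_mapsI[where C = "C + D"])
    fix x :: "nat \<Rightarrow> 'a" assume x: "x \<in> HA"
    have "HA_norm (T x - S x) \<le> HA_norm (T x) + HA_norm (S x)"
      using HA_norm_triangle[OF bounded_maps_in[OF T x] HA_minus[OF bounded_maps_in[OF S x]]] by simp
    then show "HA_norm (T x - S x) \<le> (C + D) * HA_norm x"
      using C[OF x] D[OF x] by (simp add: distrib_right)
  qed (simp_all add: HA_diff bounded_maps_in[OF T] bounded_maps_in[OF S] bounded_maps_add[OF T]
      bounded_maps_add[OF S] bounded_maps_right_act[OF T] bounded_maps_right_act[OF S] right_act_diff)
qed

lemma bounded_ops_id: "(\<lambda>x. x) \<in> bounded_ops M"
  by (rule bounded_mapsI[where C = 1]) simp_all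

lemma bounded_ops_central:
  assumes "\<alpha> \<in> alg_center"
  shows "(\<lambda>x. right_act x \<alpha>) \<in> bounded_ops HA"
proof (rule bounded_mapsI[where C = "norm \<alpha>"])
  have "a * \<alpha> = \<alpha> * a" for a using assms by (simp add: alg_center_def)
  then show "right_act (right_act x a) \<alpha> = right_act (right_act x \<alpha>) a" for x a
    by (simp add: right_act_right_act)
qed (simp_all add: HA_right_act right_act_add HA_norm_right_act)

lemma bounded_maps_zero:
  assumes "T \<in> bounded_maps M N" "submodule M"
  shows "T 0 = 0"
  using bounded_maps_right_act[OF assms(1) submodule_zero[OF assms(2)], of 0] by simp

lemma bounded_maps_diff:
  assumes "T \<in> bounded_maps M N" "submodule M" "x \<in> M" "y \<in> M"
  shows "T (x - y) = T x - T y"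
proof -
  have "T (- y) = - T y"
    using bounded_maps_right_act[OF assms(1,4), of "- 1"] by (simp only: right_act_minus_one)
  then show ?thesis
    using bounded_maps_add[OF assms(1,3) submodule_minus[OF assms(2,4)]] by simp
qed

lemma bounded_maps_sum:
  assumes "T \<in> bounded_maps M N" "submodule M" "\<And>i. i \<in> I \<Longrightarrow> f i \<in> M"
  shows "T (sum f I) = (\<Sum>i\<in>I. T (f i))"
  using assms(3)
proof (induction I rule: infinite_finite_induct)
  case (insert i I)
  then have "T (f i + sum f I) = T (f i) + T (sum f I)"
    by (intro bounded_maps_add[OF assms(1)] submodule_sum[OF assms(2)]) auto
  also have "T (sum f I) = (\<Sum>i\<in>I. T (f i))" by (rule insert.IH) (use insert.prems in auto)
  finally show ?case by (simp only: sum.insert[OF insert.hyps])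
qed (simp_all add: bounded_maps_zero[OF assms(1,2)])

lemma submodule_op_kernel:
  assumes T: "T \<in> bounded_ops HA"
  shows "submodule (op_kernel T)"
  by (auto simp: submodule_def op_kernel_def HA_add HA_right_act bounded_maps_add[OF T]
      bounded_maps_right_act[OF T] bounded_maps_zero[OF T submodule_whole])

lemma closed_submodule_op_kernel:
  assumes T: "T \<in> bounded_ops HA"
  shows "closed_submodule (op_kernel T)"
  unfolding closed_submodule_def
proof (intro conjI allI ballI impI)
  fix X and l :: "nat \<Rightarrow> 'a"
  assume l: "l \<in> HA" and X: "(\<forall>k. X k \<in> op_kernel T) \<and> (\<lambda>k. HA_norm (X k - l)) \<longlonglongrightarrow> 0"
  then have XHA: "X k \<in> HA" and TX: "T (X k) = 0" for k by (auto simp: op_kernel_def)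
  obtain C where C: "\<And>x. x \<in> HA \<Longrightarrow> HA_norm (T x) \<le> C * HA_norm x"
    using bounded_maps_bound[OF T] by blast
  have "HA_norm (T l) \<le> C * HA_norm (X k - l)" for k
    using C[OF HA_diff[OF XHA l]] bounded_maps_diff[OF T submodule_whole XHA l]
    by (simp add: TX)
  moreover have "(\<lambda>k. C * HA_norm (X k - l)) \<longlonglongrightarrow> C * 0"
    using X by (intro tendsto_mult_left) blast
  ultimately have "HA_norm (T l) \<le> C * 0" by (intro LIMSEQ_le_const) auto
  then have "T l = 0" using HA_norm_eq_zeroD[OF bounded_maps_in[OF T l]] by (simp add: order_antisym)
  then show "l \<in> op_kernel T" using l by (simp add: op_kernel_def)
qed (rule submodule_op_kernel[OF T])

lemma op_range_idempotent:
  assumes Q: "Q \<in> bounded_ops HA" and idem: "\<And>x. x \<in> HA \<Longrightarrow> Q (Q x) = Q x"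
  shows "op_range Q = op_kernel (\<lambda>x. x - Q x)"
proof -
  have "x \<in> op_range Q \<longleftrightarrow> x \<in> HA \<and> x - Q x = 0" for x
  proof
    assume "x \<in> op_range Q"
    then obtain y where y: "y \<in> HA" "x = Q y" by (auto simp: op_range_def)
    then show "x \<in> HA \<and> x - Q x = 0" by (simp only: bounded_maps_in[OF Q] idem diff_self simp_thms)
  next
    assume "x \<in> HA \<and> x - Q x = 0"
    then have "x \<in> HA" "x = Q x" by simp_all
    then show "x \<in> op_range Q" unfolding op_range_def by blast
  qed
  then show ?thesis by (simp only: op_kernel_def set_eq_iff mem_Collect_eq simp_thms)
qed

lemma idempotent_direct_sum:
  assumes Q: "Q \<in> bounded_ops HA" and idem: "\<And>x. x \<in> HA \<Longrightarrow> Q (Q x) = Q x"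
  shows "direct_sum (op_range Q) (op_kernel Q)"
proof -
  have range_eq: "op_range Q = op_kernel (\<lambda>x. x - Q x)"
    by (rule op_range_idempotent[OF Q]) (rule idem)
  have Q0: "Q 0 = 0" by (rule bounded_maps_zero[OF Q submodule_whole])
  have dec: "\<exists>u v. x = u + v \<and> u \<in> op_range Q \<and> v \<in> op_kernel Q" if "x \<in> HA" for x
  proof (intro exI conjI)
    show "x = Q x + (x - Q x)" by simp
    show "Q x \<in> op_range Q" using that by (simp add: op_range_def)
    show "x - Q x \<in> op_kernel Q"
      using that bounded_maps_in[OF Q that]
      by (simp add: op_kernel_def HA_diff bounded_maps_diff[OF Q submodule_whole] idem)
  qed
  show ?thesis
    unfolding direct_sum_def
  proof (intro conjI)
    show "closed_submodule (op_range Q)"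
      unfolding range_eq by (rule closed_submodule_op_kernel[OF bounded_ops_diff[OF bounded_ops_id Q]])
    show "closed_submodule (op_kernel Q)" by (rule closed_submodule_op_kernel[OF Q])
    show "op_range Q \<inter> op_kernel Q = {0}"
      unfolding range_eq by (auto simp: op_kernel_def Q0)
    show "{x + y |x y. x \<in> op_range Q \<and> y \<in> op_kernel Q} = HA"
      using dec unfolding range_eq by (auto simp: op_kernel_def HA_add)
  qed
qed

section \<open>Bounded projections from the Baire category theorem\<close>

lemma direct_sum_left: "direct_sum M N \<Longrightarrow> submodule M"
  and direct_sum_right: "direct_sum M N \<Longrightarrow> submodule N"
  by (auto simp: direct_sum_def closed_submodule_def)

lemma direct_sum_decompose:
  assumes "direct_sum M N" "x \<in> HA"
  obtains m n where "m \<in> M" "n \<in> N" "x = m + n"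
  using assms unfolding direct_sum_def by blast

lemma direct_sum_unique:
  assumes "direct_sum M N" "m \<in> M" "m' \<in> M" "n \<in> N" "n' \<in> N" "m + n = m' + n'"
  shows "m = m'"
proof -
  have "m - m' = n' - n" using assms(6) by (simp add: algebra_simps)
  then have "m - m' \<in> M \<inter> N"
    using submodule_diff[OF direct_sum_left[OF assms(1)] assms(2,3)]
      submodule_diff[OF direct_sum_right[OF assms(1)] assms(5,4)] by simp
  then have "m - m' = 0" using assms(1) unfolding direct_sum_def by blast
  then show ?thesis by simp
qed

lemma HA_norm_sum:
  "(\<And>i. i \<in> I \<Longrightarrow> f i \<in> HA) \<Longrightarrow> HA_norm (sum f I) \<le> (\<Sum>i\<in>I. HA_norm (f i))"
proof (induction I rule: infinite_finite_induct)
  case (insert i I)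
  then have "HA_norm (f i + sum f I) \<le> HA_norm (f i) + HA_norm (sum f I)"
    by (intro HA_norm_triangle submodule_sum[OF submodule_whole]) auto
  moreover have "HA_norm (sum f I) \<le> (\<Sum>i\<in>I. HA_norm (f i))" by (rule insert.IH) (use insert.prems in auto)
  ultimately show ?case by (simp only: sum.insert[OF insert.hyps])
qed simp_all

lemma geometric_series_converges:
  assumes M: "closed_submodule M" and y: "\<And>i. y i \<in> M"
    and b: "\<And>i. HA_norm (y i) \<le> c * (1/2) ^ i"
  obtains m where "m \<in> M" "(\<lambda>k. HA_norm (sum y {..<k} - m)) \<longlonglongrightarrow> 0" "HA_norm m \<le> 2 * c"
proof -
  note sub = closed_submodule_submodule[OF M]
  have yHA: "y i \<in> HA" for i using submodule_HA[OF sub y] .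
  have SM: "sum y I \<in> M" for I by (rule submodule_sum[OF sub y])
  have S: "sum y I \<in> HA" for I using submodule_HA[OF sub SM] .
  have c: "0 \<le> c" using order_trans[OF HA_norm_nonneg b[of 0]] by simp
  have geo: "(\<Sum>i=p..<q. c * (1/2) ^ i) \<le> 2 * c * (1/2) ^ p" for p q
  proof (cases "p \<le> q")
    case True
    have "(\<Sum>i=p..<q. c * (1/2) ^ i) = 2 * c * (1/2) ^ p - 2 * c * (1/2) ^ q"
      using True by (induction q rule: dec_induct) simp_all
    then show ?thesis using c by simp
  qed (use c in simp)
  have bound: "HA_norm (sum y {p..<q}) \<le> 2 * c * (1/2) ^ p" for p q
    by (rule order_trans[OF HA_norm_sum[OF yHA] order_trans[OF sum_mono[OF b] geo]])
  have diff: "HA_norm (sum y {..<q} - sum y {..<p}) \<le> 2 * c * (1/2) ^ p" if "p \<le> q" for p q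
  proof -
    have "sum y {..<q} = sum y {..<p} + sum y {p..<q}"
      using sum.atLeastLessThan_concat[of 0 p q y] that by (simp add: lessThan_atLeast0)
    then show ?thesis using bound by simp
  qed
  have "\<exists>l\<in>HA. (\<lambda>k. HA_norm (sum y {..<k} - l)) \<longlonglongrightarrow> 0"
  proof (rule HA_complete[OF S])
    fix e :: real assume "0 < e"
    have "(\<lambda>p. 2 * c * (1/2) ^ p) \<longlonglongrightarrow> 2 * c * 0"
      by (intro tendsto_mult_left LIMSEQ_realpow_zero) simp_all
    then obtain N where N: "\<And>p. N \<le> p \<Longrightarrow> 2 * c * (1/2) ^ p < e"
      using order_tendstoD(2)[of _ 0 sequentially e] \<open>0 < e\<close> by (auto simp: eventually_sequentially)
    have "HA_norm (sum y {..<p} - sum y {..<q}) < e" if "N \<le> p" "N \<le> q" for p q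
    proof (cases "p \<le> q")
      case True
      show ?thesis
        unfolding HA_norm_minus_commute[of "sum y {..<p}"]
        using diff[OF True] N[OF that(1)] by linarith
    next
      case False
      then show ?thesis using diff[of q p] N[OF that(2)] by linarith
    qed
    then show "\<exists>N. \<forall>p\<ge>N. \<forall>q\<ge>N. HA_norm (sum y {..<p} - sum y {..<q}) < e" by blast
  qed
  then obtain m where m: "m \<in> HA" "(\<lambda>k. HA_norm (sum y {..<k} - m)) \<longlonglongrightarrow> 0" by blast
  have "HA_norm m \<le> HA_norm (sum y {..<k} - m) + 2 * c" for k
  proof -
    have "HA_norm (m - 0) \<le> HA_norm (m - sum y {..<k}) + HA_norm (sum y {..<k} - 0)"
      by (rule HA_norm_triangle_diff[OF m(1) S HA_zero])
    then show ?thesis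
      using diff[of 0 k] by (simp add: HA_norm_minus_commute)
  qed
  then have "HA_norm m \<le> 0 + 2 * c"
    by (intro LIMSEQ_le_const[OF tendsto_add[OF m(2) tendsto_const]]) auto
  moreover have "m \<in> M" by (rule closed_submodule_limit[OF M m(1) SM m(2)])
  ultimately show ?thesis using that m(2) by simp
qed

text \<open>Baire's theorem yields a ball in which the sums \<open>m + n\<close> with \<open>\<parallel>m\<parallel>, \<parallel>n\<parallel> \<le> k\<close> are dense.
  Differences of such sums approximate every vector of a ball around zero.\<close>

lemma direct_sum_almost_open:
  assumes MN: "direct_sum M N"
  obtains k r :: real where "0 \<le> k" "0 < r"
    "\<And>z e. z \<in> HA \<Longrightarrow> HA_norm z < r \<Longrightarrow> 0 < e \<Longrightarrow>
      \<exists>m\<in>M. \<exists>n\<in>N. HA_norm m \<le> k \<and> HA_norm n \<le> k \<and> HA_norm (z - (m + n)) < e"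
proof -
  note M = direct_sum_left[OF MN] and N = direct_sum_right[OF MN]
  define A where "A k = {m + n | m n. m \<in> M \<and> n \<in> N \<and> HA_norm m \<le> real k \<and> HA_norm n \<le> real k}" for k :: nat
  define cl where "cl k = HA.mtopology closure_of A k" for k
  have A: "A k \<subseteq> HA" for k
    using HA_add submodule_HA[OF M] submodule_HA[OF N] by (auto simp: A_def)
  have "x \<in> (\<Union>k. cl k)" if x: "x \<in> HA" for x
  proof -
    obtain m n where mn: "m \<in> M" "n \<in> N" "x = m + n" using direct_sum_decompose[OF MN x] by blast
    obtain k :: nat where "max (HA_norm m) (HA_norm n) \<le> real k" using real_arch_simple by metis
    then have "x \<in> A k" using mn by (auto simp: A_def)
    then show ?thesis using closure_of_subset[of "A k" HA.mtopology] A by (auto simp: cl_def)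
  qed
  moreover have "cl k \<subseteq> HA" for k
    using closure_of_subset_topspace[of HA.mtopology "A k"] by (simp add: cl_def)
  ultimately have "(\<Union>k. cl k) = HA" by blast
  then have "HA.mtopology interior_of \<Union>(range cl) = HA"
    using interior_of_topspace[of HA.mtopology] by simp
  then have nonempty: "HA.mtopology interior_of \<Union>(range cl) \<noteq> {}" using HA_zero by blast
  have "\<exists>k. HA.mtopology interior_of (cl k) \<noteq> {}"
  proof (rule ccontr)
    assume "\<nexists>k. HA.mtopology interior_of (cl k) \<noteq> {}"
    then have "HA.mtopology interior_of \<Union>(range cl) = {}"
      by (intro HA.metric_Baire_category_alt[OF HA_mcomplete]) (auto simp: cl_def)
    then show False using nonempty by contradiction
  qed
  then obtain k where "HA.mtopology interior_of (cl k) \<noteq> {}" by blast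
  then obtain x0 where "x0 \<in> HA.mtopology interior_of (cl k)" by blast
  then obtain r where x0: "x0 \<in> HA" and r: "0 < r" and ball: "HA.mball x0 r \<subseteq> cl k"
    unfolding HA.metric_interior_of by blast
  have approx: "\<exists>m\<in>M. \<exists>n\<in>N. HA_norm m \<le> k \<and> HA_norm n \<le> k \<and> HA_norm (x - (m + n)) < e"
    if "x \<in> HA" "HA_norm (x0 - x) < r" "0 < e" for x e
  proof -
    have "x \<in> cl k" using ball that x0 by auto
    then obtain y where "y \<in> A k" "y \<in> HA.mball x e"
      unfolding cl_def HA.metric_closure_of using \<open>0 < e\<close> by blast
    then show ?thesis unfolding A_def by auto
  qed
  show ?thesis
  proof (rule that[of "2 * real k" r])
    fix z :: "nat \<Rightarrow> 'a" and e :: real assume z: "z \<in> HA" "HA_norm z < r" and "0 < e"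
    then have e2: "0 < e / 2" by simp
    have "HA_norm (x0 - (x0 + z)) < r" using z by simp
    then obtain m n where mn: "m \<in> M" "n \<in> N" "HA_norm m \<le> k" "HA_norm n \<le> k"
      "HA_norm (x0 + z - (m + n)) < e / 2"
      using approx[OF HA_add[OF x0 z(1)] _ e2] by blast
    obtain m' n' where mn': "m' \<in> M" "n' \<in> N" "HA_norm m' \<le> k" "HA_norm n' \<le> k"
      "HA_norm (x0 - (m' + n')) < e / 2"
      using approx[OF x0 _ e2] r by auto
    note inHA = submodule_HA[OF M mn(1)] submodule_HA[OF M mn'(1)] submodule_HA[OF N mn(2)]
      submodule_HA[OF N mn'(2)]
    show "\<exists>m\<in>M. \<exists>n\<in>N. HA_norm m \<le> 2 * real k \<and> HA_norm n \<le> 2 * real k \<and> HA_norm (z - (m + n)) < e"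
    proof (intro bexI conjI)
      show "m - m' \<in> M" using submodule_diff[OF M] mn mn' by blast
      show "n - n' \<in> N" using submodule_diff[OF N] mn mn' by blast
      show "HA_norm (m - m') \<le> 2 * real k"
        using HA_norm_triangle[OF inHA(1) HA_minus[OF inHA(2)]] mn mn' by simp
      show "HA_norm (n - n') \<le> 2 * real k"
        using HA_norm_triangle[OF inHA(3) HA_minus[OF inHA(4)]] mn mn' by simp
      have eq: "z - (m - m' + (n - n')) = (x0 + z - (m + n)) + - (x0 - (m' + n'))"
        by (simp add: algebra_simps)
      have "HA_norm (z - (m - m' + (n - n'))) \<le> HA_norm (x0 + z - (m + n)) + HA_norm (- (x0 - (m' + n')))"
        unfolding eq using inHA x0 z by (intro HA_norm_triangle HA_minus HA_diff HA_add)
      then show "HA_norm (z - (m - m' + (n - n'))) < e"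
        unfolding HA_norm_minus using mn(5) mn'(5) by linarith
    qed
  qed (use r in simp_all)
qed

text \<open>The homogeneous form of the previous lemma: the tolerance is half the norm of the vector.\<close>

lemma direct_sum_halving:
  assumes MN: "direct_sum M N"
  obtains K :: real where "0 \<le> K" "\<And>z. z \<in> HA \<Longrightarrow>
      \<exists>m\<in>M. \<exists>n\<in>N. HA_norm m \<le> K * HA_norm z \<and> HA_norm n \<le> K * HA_norm z \<and>
        HA_norm (z - (m + n)) \<le> HA_norm z / 2"
proof -
  note M = direct_sum_left[OF MN] and N = direct_sum_right[OF MN]
  obtain k r :: real where k: "0 \<le> k" and r: "0 < r" and open_at_0:
    "\<And>z e. z \<in> HA \<Longrightarrow> HA_norm z < r \<Longrightarrow> 0 < e \<Longrightarrow>
      \<exists>m\<in>M. \<exists>n\<in>N. HA_norm m \<le> k \<and> HA_norm n \<le> k \<and> HA_norm (z - (m + n)) < e"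
    using direct_sum_almost_open[OF MN] by blast
  show ?thesis
  proof (rule that[of "2 * k / r"])
    fix z :: "nat \<Rightarrow> 'a" assume z: "z \<in> HA"
    show "\<exists>m\<in>M. \<exists>n\<in>N. HA_norm m \<le> 2 * k / r * HA_norm z \<and> HA_norm n \<le> 2 * k / r * HA_norm z \<and>
        HA_norm (z - (m + n)) \<le> HA_norm z / 2"
    proof (cases "HA_norm z = 0")
      case True
      then show ?thesis
        using submodule_zero[OF M] submodule_zero[OF N] by (intro bexI[of _ 0]) simp_all
    next
      case False
      then have z0: "0 < HA_norm z" by (simp add: order_less_le)
      \<comment> \<open>The factor 2 puts the rescaled vector strictly inside the ball of radius \<open>r\<close>.\<close>
      define s where "s = r / (2 * HA_norm z)"
      have s: "0 < s" using r z0 by (simp add: s_def)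
      define w where "w = right_act z (s *\<^sub>R 1)"
      have w: "w \<in> HA" by (simp add: w_def HA_right_act z)
      have "HA_norm w \<le> s * HA_norm z" using HA_norm_scaleR[OF z, of s] s by (simp add: w_def)
      also have "\<dots> < r" using z0 r by (simp add: s_def)
      finally have "HA_norm w < r" .
      moreover have "0 < s * HA_norm z / 2" using s z0 by simp
      ultimately obtain m n where mn: "m \<in> M" "n \<in> N" "HA_norm m \<le> k" "HA_norm n \<le> k"
        "HA_norm (w - (m + n)) < s * HA_norm z / 2"
        using open_at_0[OF w] by blast
      note mHA = submodule_HA[OF M mn(1)] and nHA = submodule_HA[OF N mn(2)]
      have scale: "HA_norm (right_act x ((1 / s) *\<^sub>R 1)) \<le> c / s" if "x \<in> HA" "HA_norm x \<le> c" for x c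
        by (rule order_trans[OF HA_norm_scaleR[OF that(1)]])
           (use s that(2) in \<open>simp add: divide_right_mono\<close>)
      have ks: "k / s = 2 * k / r * HA_norm z" using z0 r by (simp add: s_def)
      have "z = right_act w ((1 / s) *\<^sub>R 1)"
        using s by (simp add: w_def right_act_right_act) (simp add: right_act_def)
      then have zeq: "z - (right_act m ((1 / s) *\<^sub>R 1) + right_act n ((1 / s) *\<^sub>R 1)) =
          right_act (w - (m + n)) ((1 / s) *\<^sub>R 1)"
        by (simp only: right_act_diff right_act_add)
      show ?thesis
      proof (intro bexI conjI)
        show "right_act m ((1 / s) *\<^sub>R 1) \<in> M" "right_act n ((1 / s) *\<^sub>R 1) \<in> N"
          using submodule_right_act M N mn by blast+
        show "HA_norm (right_act m ((1 / s) *\<^sub>R 1)) \<le> 2 * k / r * HA_norm z"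
          "HA_norm (right_act n ((1 / s) *\<^sub>R 1)) \<le> 2 * k / r * HA_norm z"
          using scale[OF mHA mn(3)] scale[OF nHA mn(4)] ks by simp_all
        have "HA_norm (right_act (w - (m + n)) ((1 / s) *\<^sub>R 1)) \<le> (s * HA_norm z / 2) / s"
          by (rule scale[OF HA_diff[OF w HA_add[OF mHA nHA]] less_imp_le[OF mn(5)]])
        then show "HA_norm (z - (right_act m ((1 / s) *\<^sub>R 1) + right_act n ((1 / s) *\<^sub>R 1))) \<le> HA_norm z / 2"
          unfolding zeq using s by simp
      qed
    qed
  qed (use k r in simp)
qed

text \<open>Repeated halving of the remainder writes \<open>z\<close> as a sum of two geometrically convergent series,
  one in \<open>M\<close> and one in \<open>N\<close>. By uniqueness their limits are the components of \<open>z\<close>.\<close>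

lemma direct_sum_bounded:
  assumes MN: "direct_sum M N"
  obtains C where "\<And>m n. m \<in> M \<Longrightarrow> n \<in> N \<Longrightarrow> HA_norm m \<le> C * HA_norm (m + n)"
proof -
  note M = direct_sum_left[OF MN] and N = direct_sum_right[OF MN]
  have closed: "closed_submodule M" "closed_submodule N" using MN by (auto simp: direct_sum_def)
  obtain K where K: "0 \<le> K" and halving: "\<And>z. z \<in> HA \<Longrightarrow>
      \<exists>m\<in>M. \<exists>n\<in>N. HA_norm m \<le> K * HA_norm z \<and> HA_norm n \<le> K * HA_norm z \<and>
        HA_norm (z - (m + n)) \<le> HA_norm z / 2"
    using direct_sum_halving[OF MN] by blast
  then obtain f g where fg: "\<And>z. z \<in> HA \<Longrightarrow> f z \<in> M \<and> g z \<in> N \<and> HA_norm (f z) \<le> K * HA_norm z \<and>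
      HA_norm (g z) \<le> K * HA_norm z \<and> HA_norm (z - (f z + g z)) \<le> HA_norm z / 2"
    by metis
  show ?thesis
  proof (rule that[of "2 * K"])
    fix m0 n0 assume m0: "m0 \<in> M" and n0: "n0 \<in> N"
    define z where "z = m0 + n0"
    define w where "w = rec_nat z (\<lambda>_ u. u - (f u + g u))"
    have w0: "w 0 = z" and wS: "w (Suc i) = w i - (f (w i) + g (w i))" for i by (simp_all add: w_def)
    have zHA: "z \<in> HA" using HA_add submodule_HA[OF M m0] submodule_HA[OF N n0] by (simp add: z_def)
    have wHA: "w i \<in> HA" for i
    proof (induction i)
      case (Suc i)
      then show ?case
        unfolding wS using fg[OF Suc] submodule_HA[OF M] submodule_HA[OF N] by (intro HA_diff HA_add) auto
    qed (simp add: w0 zHA)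
    have wb: "HA_norm (w i) \<le> HA_norm z * (1/2) ^ i" for i
    proof (induction i)
      case (Suc i)
      have "HA_norm (w (Suc i)) \<le> HA_norm (w i) / 2" unfolding wS using fg[OF wHA[of i]] by blast
      then show ?case using Suc by simp
    qed (simp add: w0)
    have fM: "f (w i) \<in> M" and gN: "g (w i) \<in> N" for i using fg[OF wHA] by blast+
    have fb: "HA_norm (f (w i)) \<le> K * HA_norm z * (1/2) ^ i"
      and gb: "HA_norm (g (w i)) \<le> K * HA_norm z * (1/2) ^ i" for i
      using fg[OF wHA[of i]] mult_left_mono[OF wb[of i] K] by (simp_all add: mult.assoc)
    obtain m where m: "m \<in> M" "(\<lambda>k. HA_norm ((\<Sum>i<k. f (w i)) - m)) \<longlonglongrightarrow> 0"
        "HA_norm m \<le> 2 * (K * HA_norm z)"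
      using geometric_series_converges[OF closed(1) fM fb] by blast
    obtain n where n: "n \<in> N" "(\<lambda>k. HA_norm ((\<Sum>i<k. g (w i)) - n)) \<longlonglongrightarrow> 0"
      using geometric_series_converges[OF closed(2) gN gb] by blast
    note inHA = submodule_HA[OF M m(1)] submodule_HA[OF N n(1)]
    have fsum: "(\<Sum>i<k. f (w i)) \<in> HA" and gsum: "(\<Sum>i<k. g (w i)) \<in> HA" for k
      by (intro submodule_sum[OF submodule_whole] submodule_HA[OF M fM] submodule_HA[OF N gN])+
    have wk: "w k = z - ((\<Sum>i<k. f (w i)) + (\<Sum>i<k. g (w i)))" for k
    proof (induction k)
      case (Suc k)
      have "w (Suc k) = z - ((\<Sum>i<k. f (w i)) + (\<Sum>i<k. g (w i))) - (f (w k) + g (w k))"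
        by (rule trans[OF wS arg_cong[OF Suc.IH, of "\<lambda>u. u - (f (w k) + g (w k))"]])
      then show ?case by (simp only: sum.lessThan_Suc diff_diff_eq add_ac)
    qed (simp add: w0)
    have lim0: "(\<lambda>k. HA_norm z * (1/2) ^ k) \<longlonglongrightarrow> 0"
      using tendsto_mult_left[OF LIMSEQ_realpow_zero[of "1/2"], of "HA_norm z"] by simp
    have "(\<lambda>k. HA_norm (w k)) \<longlonglongrightarrow> 0"
      by (rule tendsto_sandwich[OF _ _ tendsto_const lim0]) (simp_all add: wb)
    then have "(\<lambda>k. HA_norm (((\<Sum>i<k. f (w i)) + (\<Sum>i<k. g (w i))) - z)) \<longlonglongrightarrow> 0"
      by (simp only: trans[OF arg_cong[OF wk, of HA_norm] HA_norm_minus_commute])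
    moreover have "(\<lambda>k. HA_norm (((\<Sum>i<k. f (w i)) + (\<Sum>i<k. g (w i))) - (m + n))) \<longlonglongrightarrow> 0"
    proof (rule tendsto_sandwich[OF _ _ tendsto_const])
      show "(\<lambda>k. HA_norm ((\<Sum>i<k. f (w i)) - m) + HA_norm ((\<Sum>i<k. g (w i)) - n)) \<longlonglongrightarrow> 0"
        using tendsto_add[OF m(2) n(2)] by simp
      have "HA_norm (((\<Sum>i<k. f (w i)) + (\<Sum>i<k. g (w i))) - (m + n))
          \<le> HA_norm ((\<Sum>i<k. f (w i)) - m) + HA_norm ((\<Sum>i<k. g (w i)) - n)" for k
        unfolding add_diff_add by (intro HA_norm_triangle HA_diff fsum gsum inHA)
      then show "\<forall>\<^sub>F k in sequentially. HA_norm (((\<Sum>i<k. f (w i)) + (\<Sum>i<k. g (w i))) - (m + n))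
          \<le> HA_norm ((\<Sum>i<k. f (w i)) - m) + HA_norm ((\<Sum>i<k. g (w i)) - n)" by simp
    qed simp
    ultimately have "z = m + n"
      by (intro HA_limit_unique[where X = "\<lambda>k. (\<Sum>i<k. f (w i)) + (\<Sum>i<k. g (w i))"]
          HA_add fsum gsum zHA inHA)
    then have "m0 = m" using direct_sum_unique[OF MN m0 m(1) n0 n(1)] by (simp add: z_def)
    then show "HA_norm m0 \<le> 2 * K * HA_norm (m0 + n0)" using m(3) by (simp add: z_def)
  qed
qed

definition projection_along :: "(nat \<Rightarrow> 'a::unital_cstar_algebra) set \<Rightarrow> (nat \<Rightarrow> 'a) set \<Rightarrow>
    (nat \<Rightarrow> 'a) \<Rightarrow> (nat \<Rightarrow> 'a)" where
  "projection_along N M x = (THE m. m \<in> M \<and> x - m \<in> N)"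

lemma projection_along_eq:
  assumes "direct_sum M N" "m \<in> M" "n \<in> N"
  shows "projection_along N M (m + n) = m"
  unfolding projection_along_def
proof (rule the_equality)
  fix m' assume "m' \<in> M \<and> m + n - m' \<in> N"
  then show "m' = m" using direct_sum_unique[OF assms(1), of m' m "m + n - m'" n] assms by simp
qed (use assms in simp)

lemma projection_along_bounded:
  assumes MN: "direct_sum M N"
  shows "projection_along N M \<in> bounded_maps HA M"
proof -
  note M = direct_sum_left[OF MN] and N = direct_sum_right[OF MN]
  note eq = projection_along_eq[OF MN]
  obtain C where C: "\<And>m n. m \<in> M \<Longrightarrow> n \<in> N \<Longrightarrow> HA_norm m \<le> C * HA_norm (m + n)"
    using direct_sum_bounded[OF MN] by blast
  show ?thesis
  proof (rule bounded_mapsI[where C = C])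
    fix x :: "nat \<Rightarrow> 'a" assume x: "x \<in> HA"
    obtain m n where mn: "m \<in> M" "n \<in> N" "x = m + n" using direct_sum_decompose[OF MN x] by blast
    show "projection_along N M x \<in> M" using mn eq by simp
    show "HA_norm (projection_along N M x) \<le> C * HA_norm x" using mn eq C by simp
    show "projection_along N M (right_act x a) = right_act (projection_along N M x) a" for a
      using mn eq[of "right_act m a" "right_act n a"] submodule_right_act[OF M mn(1)]
        submodule_right_act[OF N mn(2)] eq[OF mn(1,2)] by (simp add: right_act_add)
    fix y :: "nat \<Rightarrow> 'a" assume y: "y \<in> HA"
    obtain m' n' where mn': "m' \<in> M" "n' \<in> N" "y = m' + n'" using direct_sum_decompose[OF MN y] by blast
    have "x + y = (m + m') + (n + n')" using mn mn' by (simp add: algebra_simps)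
    then show "projection_along N M (x + y) = projection_along N M x + projection_along N M y"
      using eq[OF submodule_add[OF M mn(1) mn'(1)] submodule_add[OF N mn(2) mn'(2)]]
        eq[OF mn(1,2)] eq[OF mn'(1,2)] mn(3) mn'(3) by (simp only:)
  qed
qed

section \<open>Weyl operators and invertible compressions\<close>

lemma right_act_sum_right: "right_act x (sum c I) = (\<Sum>i\<in>I. right_act x (c i))"
proof (induction I rule: infinite_finite_induct)
  case (insert i I)
  then show ?case by (simp only: sum.insert[OF insert.hyps] right_act_add_right)
qed simp_all

text \<open>If \<open>T\<close> identifies generators, their coefficients add up. Conversely each generator of the
  image has one preferred preimage among the generators, which carries its coefficient.\<close>

lemma finitely_generated_image:
  assumes T: "T \<in> bounded_ops HA" and M: "finitely_generated M"
  shows "finitely_generated (T ` M)"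
proof -
  obtain S where S: "S \<subseteq> HA" "finite S" and M_eq: "M = range (\<lambda>c. \<Sum>s\<in>S. right_act s (c s))"
    using M unfolding finitely_generated_def by blast
  have T_sum: "T (\<Sum>s\<in>S. right_act s (c s)) = (\<Sum>t\<in>T ` S. right_act t (\<Sum>s\<in>{s \<in> S. T s = t}. c s))" for c
  proof -
    have "T (\<Sum>s\<in>S. right_act s (c s)) = (\<Sum>s\<in>S. T (right_act s (c s)))"
      using S(1) by (intro bounded_maps_sum[OF T submodule_whole] HA_right_act) blast
    also have "\<dots> = (\<Sum>s\<in>S. right_act (T s) (c s))"
      using S(1) by (intro sum.cong refl bounded_maps_right_act[OF T]) blast
    also have "\<dots> = (\<Sum>t\<in>T ` S. \<Sum>s\<in>{s \<in> S. T s = t}. right_act (T s) (c s))"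
      by (rule sum.image_gen[OF S(2)])
    also have "\<dots> = (\<Sum>t\<in>T ` S. right_act t (\<Sum>s\<in>{s \<in> S. T s = t}. c s))"
    proof (rule sum.cong[OF refl])
      fix t
      have "(\<Sum>s\<in>{s \<in> S. T s = t}. right_act (T s) (c s)) = (\<Sum>s\<in>{s \<in> S. T s = t}. right_act t (c s))"
        by (rule sum.cong) auto
      then show "(\<Sum>s\<in>{s \<in> S. T s = t}. right_act (T s) (c s)) = right_act t (\<Sum>s\<in>{s \<in> S. T s = t}. c s)"
        by (simp only: right_act_sum_right)
    qed
    finally show ?thesis .
  qed
  have "T ` M = range (\<lambda>c. \<Sum>t\<in>T ` S. right_act t (c t))"
  proof (intro equalityI subsetI)
    fix y assume "y \<in> T ` M"
    then obtain c where "y = T (\<Sum>s\<in>S. right_act s (c s))" unfolding M_eq by blast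
    then show "y \<in> range (\<lambda>c. \<Sum>t\<in>T ` S. right_act t (c t))" unfolding T_sum
      by (rule range_eqI[of _ _ "\<lambda>t. \<Sum>s\<in>{s \<in> S. T s = t}. c s"])
  next
    fix y assume "y \<in> range (\<lambda>c. \<Sum>t\<in>T ` S. right_act t (c t))"
    then obtain c where y: "y = (\<Sum>t\<in>T ` S. right_act t (c t))" by blast
    define c' where "c' s = (if s = inv_into S T (T s) then c (T s) else 0)" for s
    have "(\<Sum>s\<in>{s \<in> S. T s = t}. c' s) = c t" if t: "t \<in> T ` S" for t
    proof -
      have "(\<Sum>s\<in>{s \<in> S. T s = t}. c' s) = (\<Sum>s\<in>{s \<in> S. T s = t}. if s = inv_into S T t then c t else 0)"
        by (rule sum.cong) (auto simp: c'_def)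
      also have "\<dots> = c t"
        using S(2) inv_into_into[OF t] f_inv_into_f[OF t] by (simp add: sum.delta)
      finally show ?thesis .
    qed
    then have "T (\<Sum>s\<in>S. right_act s (c' s)) = y"
      unfolding T_sum y by (intro sum.cong refl arg_cong[where f = "right_act _"])
    then show "y \<in> T ` M" unfolding M_eq by blast
  qed
  moreover have "T ` S \<subseteq> HA" using bounded_maps_in[OF T] S(1) by blast
  ultimately show ?thesis unfolding finitely_generated_def using S(2) by blast
qed

lemma star_alg_center: "\<alpha> \<in> alg_center \<Longrightarrow> star \<alpha> \<in> alg_center"
  unfolding alg_center_def mem_Collect_eq by (metis star_mult star_star)

text \<open>By polarization, \<open>4 x*y\<close> is a combination of the four elements \<open>z*z\<close> with
  \<open>z = x \<plusminus> y\<close> and \<open>z = x \<plusminus> iy\<close>.\<close>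

lemma HA_summable_inner:
  assumes x: "x \<in> HA" and y: "y \<in> HA"
  shows "summable (\<lambda>n. star (x n) * y n)"
proof -
  define j where "j = scaleC \<i> (1::'a)"
  define q where "q = (\<lambda>(z :: nat \<Rightarrow> 'a) n. star (z n) * z n)"
  have q: "summable (q z)" if "z \<in> HA" for z using that by (simp add: HA_def q_def)
  have j: "a * j = j * a" "j * j = - 1" "star j = - j" for a
    by (simp_all add: j_def scaleC_mult_left scaleC_mult_right scaleC_imaginary_unit_twice
        star_scaleC scaleC_minus_left)
  have jj: "j * (j * a) = - a" for a by (simp add: j(2) flip: mult.assoc)
  define u where "u n = q (x + y) n - q (x - y) n - j * (q (x + right_act y j) n - q (x - right_act y j) n)" for n
  have "u n = 4 *\<^sub>R (star (x n) * y n)" for n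
  proof -
    have sj: "star (y n * j) = - (star (y n) * j)" by (simp add: star_mult j)
    have a: "q (x + y) n - q (x - y) n = 2 *\<^sub>R (star (x n) * y n + star (y n) * x n)"
      by (simp add: q_def star_add star_diff algebra_simps scaleR_2)
    have b: "q (x + right_act y j) n - q (x - right_act y j) n =
        2 *\<^sub>R (j * (star (x n) * y n - star (y n) * x n))"
    proof -
      have "star (x n) * (y n * j) = j * (star (x n) * y n)" "star (y n) * j * x n = j * (star (y n) * x n)"
        using j(1) by (metis mult.assoc)+
      then show ?thesis
        by (simp add: q_def right_act_def star_add star_diff sj algebra_simps scaleR_2)
    qed
    have four: "4 *\<^sub>R v = v + (v + (v + v))" for v :: 'a
      using scaleR_add_left[of 2 2 v] by (simp add: scaleR_2 add.assoc)
    show ?thesis unfolding u_def a b four by (simp add: jj algebra_simps scaleR_2)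
  qed
  then have u_eq: "u = (\<lambda>n. 4 *\<^sub>R (star (x n) * y n))" by (rule ext)
  have "summable u"
    unfolding u_def using x y
    by (intro summable_diff summable_mult q HA_add HA_diff HA_right_act)
  then have "summable (\<lambda>n. (1/4) *\<^sub>R (4 *\<^sub>R (star (x n) * y n)))" unfolding u_eq by (rule summable_scaleR_right)
  then show ?thesis by simp
qed

lemma HA_inner_diff_left:
  "x \<in> HA \<Longrightarrow> x' \<in> HA \<Longrightarrow> y \<in> HA \<Longrightarrow> HA_inner (x - x') y = HA_inner x y - HA_inner x' y"
  by (simp add: HA_inner_def star_diff left_diff_distrib suminf_diff HA_summable_inner)

lemma HA_inner_diff_right:
  "x \<in> HA \<Longrightarrow> y \<in> HA \<Longrightarrow> y' \<in> HA \<Longrightarrow> HA_inner x (y - y') = HA_inner x y - HA_inner x y'"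
  by (simp add: HA_inner_def right_diff_distrib suminf_diff HA_summable_inner)

lemma HA_inner_right_act_left:
  "x \<in> HA \<Longrightarrow> y \<in> HA \<Longrightarrow> HA_inner (right_act x a) y = star a * HA_inner x y"
  by (simp add: HA_inner_def right_act_def star_mult mult.assoc suminf_mult HA_summable_inner)

lemma HA_inner_right_act_right:
  "x \<in> HA \<Longrightarrow> y \<in> HA \<Longrightarrow> HA_inner x (right_act y a) = HA_inner x y * a"
  by (simp add: HA_inner_def right_act_def suminf_mult2 HA_summable_inner mult.assoc)

lemma adjointable_shift:
  assumes F: "F \<in> adjointable_ops" and \<alpha>: "\<alpha> \<in> alg_center"
  shows "(\<lambda>x. F x - right_act x \<alpha>) \<in> adjointable_ops"
proof -
  have FB: "F \<in> bounded_ops HA" using F by (simp add: adjointable_ops_def)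
  obtain G where G: "G \<in> bounded_ops HA"
    and adj: "\<And>x y. x \<in> HA \<Longrightarrow> y \<in> HA \<Longrightarrow> HA_inner (F x) y = HA_inner x (G y)"
    using F by (auto simp: adjointable_ops_def)
  have central: "star \<alpha> * a = a * star \<alpha>" for a
    using star_alg_center[OF \<alpha>] by (simp add: alg_center_def)
  have adj': "HA_inner (F x - right_act x \<alpha>) y = HA_inner x (G y - right_act y (star \<alpha>))"
    if "x \<in> HA" "y \<in> HA" for x y
    using that by (simp add: HA_inner_diff_left HA_inner_diff_right HA_inner_right_act_left
        HA_inner_right_act_right bounded_maps_in[OF FB] bounded_maps_in[OF G] HA_right_act adj central)
  have FB': "(\<lambda>x. F x - right_act x \<alpha>) \<in> bounded_ops HA"
    by (intro bounded_ops_diff FB bounded_ops_central \<alpha>)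
  have GB': "(\<lambda>x. G x - right_act x (star \<alpha>)) \<in> bounded_ops HA"
    by (intro bounded_ops_diff G bounded_ops_central star_alg_center \<alpha>)
  show ?thesis
    unfolding adjointable_ops_def mem_Collect_eq
    by (intro conjI FB' bexI[OF _ GB'] ballI adj')
qed

lemma invertible_op_cong:
  assumes "submodule M" and eq: "\<And>x. x \<in> M \<Longrightarrow> T x = T' x" and inv: "invertible_op M T"
  shows "invertible_op M T'"
proof -
  obtain S where T: "T \<in> bounded_ops M" and S: "S \<in> bounded_ops M"
    and ST: "\<And>x. x \<in> M \<Longrightarrow> S (T x) = x \<and> T (S x) = x"
    using inv by (auto simp: invertible_op_def)
  have "T' \<in> bounded_ops M"
    using T eq submodule_add[OF assms(1)] submodule_right_act[OF assms(1)]
    unfolding bounded_maps_def mem_Collect_eq by (simp add: image_subset_iff)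
  moreover have "S (T' x) = x \<and> T' (S x) = x" if "x \<in> M" for x
    using ST[OF that] eq[OF that] eq[OF bounded_maps_in[OF S that]] by simp
  ultimately show ?thesis using S by (auto simp: invertible_op_def)
qed

text \<open>Write \<open>S\<close> for the inverse of \<open>PG\<close> on \<open>R(P)\<close>. Then \<open>SPG\<close> and \<open>GSP\<close> are idempotents.
  The first projects onto \<open>R(P)\<close> along \<open>N(PG)\<close> and the second onto \<open>G(R(P))\<close> along \<open>N(P)\<close>, and
  these are the two decompositions which make \<open>G\<close> diagonal. Both \<open>N(PG)\<close> and \<open>N(P)\<close> are
  complements of \<open>R(P)\<close>.\<close>

lemma MPhi0_if_compression_invertible:
  assumes G: "G \<in> adjointable_ops" and P: "P \<in> fg_kernel_projections"
    and inv: "invertible_op (op_range P) (\<lambda>x. P (G x))"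
  shows "G \<in> MPhi0"
proof -
  define M where "M = op_range P"
  have GB: "G \<in> bounded_ops HA" using G by (simp add: adjointable_ops_def)
  have PB: "P \<in> bounded_ops HA" and idem: "\<And>x. x \<in> HA \<Longrightarrow> P (P x) = P x"
    and fg: "finitely_generated (op_kernel P)"
    using P by (auto simp: fg_kernel_projections_def)
  obtain S where S: "S \<in> bounded_ops M"
    and S1: "\<And>x. x \<in> M \<Longrightarrow> S (P (G x)) = x" and S2: "\<And>x. x \<in> M \<Longrightarrow> P (G (S x)) = x"
    using inv by (auto simp: invertible_op_def M_def)
  have dP: "direct_sum M (op_kernel P)"
    unfolding M_def by (rule idempotent_direct_sum[OF PB idem])
  note subM = direct_sum_left[OF dP]
  have P_in: "P x \<in> M" if "x \<in> HA" for x using that by (simp add: M_def op_range_def)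
  have MHA: "x \<in> HA" if "x \<in> M" for x using submodule_HA[OF subM that] .
  have P_id: "P x = x" if "x \<in> M" for x using that idem by (auto simp: M_def op_range_def)
  have S_in: "S x \<in> M" if "x \<in> M" for x using bounded_maps_in[OF S that] .
  have G_in: "G x \<in> HA" if "x \<in> HA" for x using bounded_maps_in[OF GB that] .
  have S0: "S 0 = 0" by (rule bounded_maps_zero[OF S subM])
  have G0: "G 0 = 0" by (rule bounded_maps_zero[OF GB submodule_whole])
  have P0: "P 0 = 0" by (rule bounded_maps_zero[OF PB submodule_whole])
  have PBM: "P \<in> bounded_maps HA M" by (rule bounded_maps_restrict[OF PB subset_refl P_in])
  have SPB: "(\<lambda>x. S (P x)) \<in> bounded_maps HA M" by (rule bounded_maps_comp[OF PBM S])
  have SPB': "(\<lambda>x. S (P x)) \<in> bounded_ops HA"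
    by (rule bounded_maps_restrict[OF SPB subset_refl]) (simp add: MHA S_in P_in)
  define Q1 where "Q1 x = S (P (G x))" for x
  define Q2 where "Q2 x = G (S (P x))" for x
  have Q1B: "Q1 \<in> bounded_ops HA" unfolding Q1_def by (rule bounded_maps_comp[OF GB SPB'])
  have Q2B: "Q2 \<in> bounded_ops HA" unfolding Q2_def by (rule bounded_maps_comp[OF SPB' GB])
  have range1: "op_range Q1 = M"
  proof
    show "op_range Q1 \<subseteq> M" by (auto simp: op_range_def Q1_def S_in P_in G_in)
    show "M \<subseteq> op_range Q1"
    proof
      fix x assume x: "x \<in> M"
      then have "x = Q1 x" by (simp add: Q1_def S1)
      then show "x \<in> op_range Q1" unfolding op_range_def using MHA[OF x] by blast
    qed
  qed
  have range2: "op_range Q2 = G ` M"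
  proof
    show "op_range Q2 \<subseteq> G ` M" by (auto simp: op_range_def Q2_def S_in P_in)
    show "G ` M \<subseteq> op_range Q2"
    proof
      fix y assume "y \<in> G ` M"
      then obtain x where x: "x \<in> M" "y = G x" by blast
      then have "y = Q2 (G x)" by (simp add: Q2_def S1)
      then show "y \<in> op_range Q2" unfolding op_range_def using G_in[OF MHA[OF x(1)]] by blast
    qed
  qed
  have kernel2: "op_kernel Q2 = op_kernel P"
  proof -
    have "G (S (P x)) = 0 \<longleftrightarrow> P x = 0" if x: "x \<in> HA" for x
    proof
      assume "G (S (P x)) = 0"
      then have "P (G (S (P x))) = 0" by (simp only: P0)
      then show "P x = 0" by (simp only: S2[OF P_in[OF x]])
    qed (simp only: S0 G0)
    then show ?thesis by (auto simp: op_kernel_def Q2_def)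
  qed
  define N1 where "N1 = op_kernel Q1"
  have N1: "P (G x) = 0" if "x \<in> N1" for x
  proof -
    have x: "x \<in> HA" "S (P (G x)) = 0" using that by (simp_all add: N1_def op_kernel_def Q1_def)
    then have "P (G (S (P (G x)))) = 0" by (simp only: G0 P0)
    then show ?thesis by (simp only: S2[OF P_in[OF G_in[OF x(1)]]])
  qed
  have d1: "direct_sum M N1"
    unfolding N1_def range1[symmetric]
    by (rule idempotent_direct_sum[OF Q1B]) (simp add: Q1_def S1 S_in P_in G_in)
  have d2: "direct_sum (G ` M) (op_kernel P)"
    unfolding range2[symmetric] kernel2[symmetric]
    by (rule idempotent_direct_sum[OF Q2B]) (simp add: Q2_def S1 S_in P_in G_in)
  have "finitely_generated N1"
  proof -
    have "N1 = (\<lambda>x. x - Q1 x) ` op_kernel P"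
    proof (intro equalityI subsetI)
      fix x assume x: "x \<in> N1"
      then have xHA: "x \<in> HA" and Qx: "Q1 x = 0" by (simp_all add: N1_def op_kernel_def)
      have "Q1 (P x) = P x" using P_in[OF xHA] by (simp add: Q1_def S1)
      then have "Q1 (x - P x) = - P x"
        using bounded_maps_diff[OF Q1B submodule_whole xHA MHA[OF P_in[OF xHA]]] Qx by simp
      then have "x = (x - P x) - Q1 (x - P x)" by simp
      moreover have "x - P x \<in> op_kernel P"
        using xHA MHA[OF P_in[OF xHA]] bounded_maps_diff[OF PB submodule_whole xHA MHA[OF P_in[OF xHA]]]
        by (simp add: op_kernel_def HA_diff idem)
      ultimately show "x \<in> (\<lambda>x. x - Q1 x) ` op_kernel P" by blast
    next
      fix y assume "y \<in> (\<lambda>x. x - Q1 x) ` op_kernel P"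
      then obtain x where x: "x \<in> HA" "y = x - Q1 x" by (auto simp: op_kernel_def)
      have Qx: "Q1 x \<in> M" using x range1 by (auto simp: op_range_def)
      then have "Q1 (Q1 x) = Q1 x" using S1 by (simp add: Q1_def)
      then show "y \<in> N1"
        using x MHA[OF Qx] bounded_maps_diff[OF Q1B submodule_whole x(1) MHA[OF Qx]]
        by (simp add: N1_def op_kernel_def HA_diff)
    qed
    then show ?thesis
      using finitely_generated_image[OF bounded_ops_diff[OF bounded_ops_id Q1B] fg] by simp
  qed
  moreover have "isomorphism M (G ` M) G"
  proof -
    have inj: "inj_on G M" by (rule inj_on_inverseI[of _ "\<lambda>y. S (P y)"]) (rule S1)
    have "inv_into M G y = S (P y)" if "y \<in> G ` M" for y
      using that inj S1 by auto
    then have "inv_into M G \<in> bounded_maps (G ` M) M"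
    proof -
      assume eq: "\<And>y. y \<in> G ` M \<Longrightarrow> inv_into M G y = S (P y)"
      have sub: "submodule (G ` M)" by (rule direct_sum_left[OF d2])
      have b: "(\<lambda>x. S (P x)) \<in> bounded_maps (G ` M) M"
        by (rule bounded_maps_restrict[OF SPB]) (auto simp: MHA G_in S_in P_in)
      obtain C where C: "\<And>y. y \<in> G ` M \<Longrightarrow> HA_norm (S (P y)) \<le> C * HA_norm y"
        using bounded_maps_bound[OF b] by blast
      show ?thesis
      proof (rule bounded_mapsI[where C = C])
        fix x y a assume x: "x \<in> G ` M"
        show "inv_into M G x \<in> M" using x by (rule inv_into_into)
        show "inv_into M G (right_act x a) = right_act (inv_into M G x) a"
          using eq[OF x] eq[OF submodule_right_act[OF sub x]] bounded_maps_right_act[OF b x] by simp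
        show "HA_norm (inv_into M G x) \<le> C * HA_norm x" using eq[OF x] C[OF x] by simp
        assume y: "y \<in> G ` M"
        show "inv_into M G (x + y) = inv_into M G x + inv_into M G y"
          unfolding eq[OF x] eq[OF y] eq[OF submodule_add[OF sub x y]] by (rule bounded_maps_add[OF b x y])
      qed
    qed
    moreover have "G \<in> bounded_maps M (G ` M)" by (rule bounded_maps_restrict[OF GB]) (auto simp: MHA)
    ultimately show ?thesis using inj by (simp add: isomorphism_def bij_betw_def)
  qed
  moreover have "G ` N1 \<subseteq> op_kernel P"
    using N1 G_in by (auto simp: op_kernel_def N1_def)
  ultimately show ?thesis
    unfolding MPhi0_def using G d1 d2 dP fg by blast
qed

text \<open>Take for \<open>P\<close> the projection onto \<open>N\<close> along \<open>N\<^sub>2\<close>. As \<open>P\<close> kills \<open>G(N\<^sub>1)\<close>, the compression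
  \<open>PG\<close> is the composite \<open>N \<rightarrow> M\<^sub>1 \<rightarrow> M\<^sub>2 \<rightarrow> N\<close>, where the outer maps compare two complements of
  \<open>N\<^sub>1\<close> and of \<open>N\<^sub>2\<close>. Each is inverted by the projection in the opposite direction.\<close>

lemma compression_invertible_if_MPhi0:
  assumes "G \<in> MPhi0"
  shows "\<exists>P\<in>fg_kernel_projections. invertible_op (op_range P) (\<lambda>x. P (G x))"
proof -
  have G: "G \<in> bounded_ops HA" using assms by (simp add: MPhi0_def adjointable_ops_def)
  obtain M1 N1 M2 N2 N where d1: "direct_sum M1 N1" and d2: "direct_sum M2 N2"
    and GN: "G ` N1 \<subseteq> N2" and iso: "isomorphism M1 M2 G"
    and fg: "finitely_generated N2" and dN1: "direct_sum N N1" and dN2: "direct_sum N N2"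
    using assms unfolding MPhi0_def mem_Collect_eq by metis
  define P where "P = projection_along N2 N"
  have PB: "P \<in> bounded_maps HA N" unfolding P_def by (rule projection_along_bounded[OF dN2])
  have P_eq: "P (n + n2) = n" if "n \<in> N" "n2 \<in> N2" for n n2
    unfolding P_def by (rule projection_along_eq[OF dN2 that])
  note subN = direct_sum_left[OF dN2] and subN2 = direct_sum_right[OF dN2]
    and subN1 = direct_sum_right[OF dN1] and subM1 = direct_sum_left[OF d1]
  have P_id: "P n = n" if "n \<in> N" for n
    using P_eq[OF that submodule_zero[OF subN2]] by simp
  have P_0: "P n2 = 0" if "n2 \<in> N2" for n2
    using P_eq[OF submodule_zero[OF subN] that] by simp
  have PBHA: "P \<in> bounded_ops HA"
    by (rule bounded_maps_restrict[OF PB subset_refl submodule_HA[OF subN bounded_maps_in[OF PB]]])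
  have range: "op_range P = N"
  proof
    show "op_range P \<subseteq> N" using bounded_maps_in[OF PB] by (auto simp: op_range_def)
    show "N \<subseteq> op_range P"
    proof
      fix n assume n: "n \<in> N"
      show "n \<in> op_range P"
        using image_eqI[of n P n HA] P_id[OF n] submodule_HA[OF subN n] by (simp add: op_range_def)
    qed
  qed
  have kernel: "op_kernel P = N2"
  proof
    show "op_kernel P \<subseteq> N2"
    proof
      fix x assume "x \<in> op_kernel P"
      then have x: "x \<in> HA" "P x = 0" by (simp_all add: op_kernel_def)
      obtain n n2 where n: "n \<in> N" "n2 \<in> N2" "x = n + n2" using direct_sum_decompose[OF dN2 x(1)] by blast
      then have "n = 0" using P_eq[OF n(1,2)] x(2) by simp
      then show "x \<in> N2" using n by simp
    qed
    show "N2 \<subseteq> op_kernel P" using P_0 submodule_HA[OF subN2] by (auto simp: op_kernel_def)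
  qed
  have "P \<in> fg_kernel_projections"
    unfolding fg_kernel_projections_def
    using PBHA fg kernel P_id[OF bounded_maps_in[OF PB]] by simp
  moreover have "invertible_op N (\<lambda>x. P (G x))"
  proof -
    define G' where "G' = inv_into M1 G"
    have G': "G' \<in> bounded_maps M2 M1" and G'G: "\<And>x. x \<in> M1 \<Longrightarrow> G' (G x) = x"
      and GG': "\<And>y. y \<in> M2 \<Longrightarrow> G (G' y) = y" and GM: "\<And>x. x \<in> M1 \<Longrightarrow> G x \<in> M2"
      using iso unfolding isomorphism_def G'_def
      by (auto simp: bij_betw_inv_into_left bij_betw_inv_into_right bij_betw_apply)
    define S where "S x = projection_along N1 N (G' (projection_along N2 M2 x))" for x
    have M1HA: "G' \<in> bounded_maps M2 HA"
      by (rule bounded_maps_restrict[OF G' subset_refl submodule_HA[OF subM1 bounded_maps_in[OF G']]])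
    have "S \<in> bounded_maps HA N"
      unfolding S_def
      by (rule bounded_maps_comp[OF bounded_maps_comp[OF projection_along_bounded[OF d2] M1HA]
            projection_along_bounded[OF dN1]])
    then have S: "S \<in> bounded_ops N"
      by (rule bounded_maps_restrict) (use submodule_HA[OF subN] bounded_maps_in \<open>S \<in> bounded_maps HA N\<close> in blast)+
    have "(\<lambda>x. P (G x)) \<in> bounded_maps HA N" by (rule bounded_maps_comp[OF G PB])
    then have PG: "(\<lambda>x. P (G x)) \<in> bounded_ops N"
      by (rule bounded_maps_restrict)
         (use submodule_HA[OF subN] bounded_maps_in[OF PB] bounded_maps_in[OF G] in blast)+
    \<comment> \<open>\<open>S\<close> follows the three isomorphisms backwards: drop the \<open>N\<^sub>2\<close> part, undo \<open>G\<close>, drop the \<open>N\<^sub>1\<close> part.\<close>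
    have S_eq: "S (G m1 + n2) = n" if "m1 \<in> M1" "n2 \<in> N2" "n \<in> N" "n1 \<in> N1" "m1 = n + n1" for m1 n2 n n1
      unfolding S_def projection_along_eq[OF d2 GM[OF that(1)] that(2)] G'G[OF that(1)]
      unfolding that(5) by (rule projection_along_eq[OF dN1 that(3,4)])
    have "S (P (G x)) = x \<and> P (G (S x)) = x" if x: "x \<in> N" for x
    proof
      note xHA = submodule_HA[OF subN x]
      obtain m1 n1 where m: "m1 \<in> M1" "n1 \<in> N1" "x = m1 + n1" using direct_sum_decompose[OF d1 xHA] by blast
      have m1HA: "m1 \<in> HA" and n1HA: "n1 \<in> HA"
        using submodule_HA[OF subM1 m(1)] submodule_HA[OF subN1 m(2)] .
      have Gx: "G x = G m1 + G n1" unfolding m(3) by (rule bounded_maps_add[OF G m1HA n1HA])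
      obtain n n2 where n: "n \<in> N" "n2 \<in> N2" "G x = n + n2"
        using direct_sum_decompose[OF dN2 bounded_maps_in[OF G xHA]] by blast
      have "P (G x) = G x - n2" unfolding n(3) P_eq[OF n(1,2)] by simp
      also have "\<dots> = G m1 + (G n1 - n2)" unfolding Gx by (simp only: add_diff_eq)
      finally have PGx: "P (G x) = G m1 + (G n1 - n2)" .
      have "G n1 - n2 \<in> N2" using submodule_diff[OF subN2] GN m(2) n(2) by blast
      moreover have "m1 = x + - n1" using m(3) by simp
      ultimately show "S (P (G x)) = x"
        unfolding PGx using S_eq[OF m(1) _ x submodule_minus[OF subN1 m(2)]] by blast
    next
      note xHA = submodule_HA[OF subN x]
      obtain m2 n2 where m: "m2 \<in> M2" "n2 \<in> N2" "x = m2 + n2" using direct_sum_decompose[OF d2 xHA] by blast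
      have G'm: "G' m2 \<in> M1" by (rule bounded_maps_in[OF G' m(1)])
      obtain n n1 where n: "n \<in> N" "n1 \<in> N1" "G' m2 = n + n1"
        using direct_sum_decompose[OF dN1 submodule_HA[OF subM1 G'm]] by blast
      have "x = G (G' m2) + n2" unfolding m(3) GG'[OF m(1)] ..
      then have Sx: "S x = n" using S_eq[OF G'm m(2) n] by simp
      have "G n + G n1 = G (G' m2)"
        unfolding n(3) using bounded_maps_add[OF G submodule_HA[OF subN n(1)] submodule_HA[OF subN1 n(2)]] by simp
      then have "G n = m2 - G n1" unfolding GG'[OF m(1)] by (simp only: eq_diff_eq)
      then have "G n = x + - (n2 + G n1)" unfolding m(3) by simp
      moreover have "- (n2 + G n1) \<in> N2"
        using submodule_minus[OF subN2 submodule_add[OF subN2 m(2)]] GN n(2) by blast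
      ultimately show "P (G (S x)) = x" unfolding Sx using P_eq[OF x] by simp
    qed
    then show ?thesis using S PG by (auto simp: invertible_op_def)
  qed
  ultimately show ?thesis using range by blast
qed

lemma compression_shift:
  assumes F: "F \<in> bounded_ops HA" and P: "P \<in> fg_kernel_projections" and \<alpha>: "\<alpha> \<in> alg_center"
  shows "invertible_op (op_range P) (\<lambda>x. P (F x - right_act x \<alpha>)) \<longleftrightarrow>
    invertible_op (op_range P) (\<lambda>x. P (F x) - right_act x \<alpha>)"
proof -
  have PB: "P \<in> bounded_ops HA" and idem: "\<And>x. x \<in> HA \<Longrightarrow> P (P x) = P x"
    using P by (auto simp: fg_kernel_projections_def)
  have sub: "submodule (op_range P)" by (rule direct_sum_left[OF idempotent_direct_sum[OF PB idem]])
  have "P (F x - right_act x \<alpha>) = P (F x) - right_act x \<alpha>" if x: "x \<in> op_range P" for x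
  proof -
    have xHA: "x \<in> HA" and Px: "P x = x"
      using submodule_HA[OF sub x] x idem by (auto simp: op_range_def)
    show ?thesis
      using bounded_maps_diff[OF PB submodule_whole bounded_maps_in[OF F xHA] HA_right_act[OF xHA]]
        bounded_maps_right_act[OF PB xHA] Px by simp
  qed
  then show ?thesis using invertible_op_cong[OF sub] by (metis (no_types, lifting))
qed

text \<open>The intersection in the theorem runs over a nonempty family, so that it consists of central
  elements only.\<close>

lemma identity_fg_kernel_projection: "(\<lambda>x. x) \<in> fg_kernel_projections"
proof -
  have "op_kernel (\<lambda>x. x) = range (\<lambda>c. \<Sum>s\<in>{}. right_act s (c s))"
    by (auto simp: op_kernel_def)
  then have "finitely_generated (op_kernel (\<lambda>x. x))"
    unfolding finitely_generated_def by (intro exI[of _ "{}"] conjI) simp_all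
  then show ?thesis by (simp add: fg_kernel_projections_def bounded_ops_id)
qed

theorem theorem3p3:
  fixes F :: "(nat \<Rightarrow> 'a::unital_cstar_algebra) \<Rightarrow> (nat \<Rightarrow> 'a)"
  assumes "F \<in> adjointable_ops"
  shows "essential_weyl_spectrum F =
    (\<Inter>P\<in>fg_kernel_projections. compression_spectrum P F)"
proof -
  have FB: "F \<in> bounded_ops HA" using assms by (simp add: adjointable_ops_def)
  have key: "(\<lambda>x. F x - right_act x \<alpha>) \<in> MPhi0 \<longleftrightarrow>
      (\<exists>P\<in>fg_kernel_projections. invertible_op (op_range P) (\<lambda>x. P (F x) - right_act x \<alpha>))"
    if \<alpha>: "\<alpha> \<in> alg_center" for \<alpha>
  proof
    assume "(\<lambda>x. F x - right_act x \<alpha>) \<in> MPhi0"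
    then obtain P where "P \<in> fg_kernel_projections"
      "invertible_op (op_range P) (\<lambda>x. P (F x - right_act x \<alpha>))"
      using compression_invertible_if_MPhi0 by blast
    then show "\<exists>P\<in>fg_kernel_projections. invertible_op (op_range P) (\<lambda>x. P (F x) - right_act x \<alpha>)"
      using compression_shift[OF FB _ \<alpha>] by blast
  next
    assume "\<exists>P\<in>fg_kernel_projections. invertible_op (op_range P) (\<lambda>x. P (F x) - right_act x \<alpha>)"
    then obtain P where P: "P \<in> fg_kernel_projections"
      "invertible_op (op_range P) (\<lambda>x. P (F x - right_act x \<alpha>))"
      using compression_shift[OF FB _ \<alpha>] by blast
    show "(\<lambda>x. F x - right_act x \<alpha>) \<in> MPhi0"
      by (rule MPhi0_if_compression_invertible[OF adjointable_shift[OF assms \<alpha>] P])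
  qed
  show ?thesis
    using key identity_fg_kernel_projection
    unfolding essential_weyl_spectrum_def compression_spectrum_def by blast
qed

end
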